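(* Let $c\in\mathbb{C}$, $V=V_{Vir}(c,0)$, and $n\in\mathbb{Z}_+$. Then $A_n(V)$ is generated by the elements \[ L(-2n-1)^{i_{2n+1}}L(-2n)^{i_{2n}}\cdots L(-2)^{i_2}\mathbf{1}+O_n(V)\quad\text{and}\quad L(-2)^j\mathbf{1}+O_n(V), \] where $i_2,\dots,i_{2n+1}\in\mathbb{N}$ with $0\le 2i_2\le n$, and $j\in\mathbb{Z}_+$.
   Context: The Virasoro algebra has basis $\bar L_m$ ($m\in\mathbb{Z}$) and central $\mathbf{c}$, with $[\bar L_m,\bar L_p]=(m-p)\bar L_{m+p}+\frac{m^3-m}{12}\delta_{m+p,0}\mathbf{c}$. $M(c,0)$ is the module induced from the one-dimensional module of the span of $\bar L_m$ ($m\ge0$) and $\mathbf{c}$ on which $\mathbf{c}$ acts by $c$ and all $\bar L_m$, $m\ge0$, act by $0$; write $L(m)$ for the action of $\bar L_m$. $V_{Vir}(c,0)=M(c,0)/\langle L(-1)\mathbf{1}\rangle$ is a vertex operator algebra with vacuum $\mathbf{1}$ and conformal vector $\omega=L(-2)\mathbf{1}$, $Y(\omega,x)=\sum_mL(m)x^{-m-2}$. For a vertex operator algebra $V$, $n\in\mathbb{N}$, homogeneous $u$: $u\circ_nv=\mathrm{Res}_x(1+x)^{\mathrm{wt}\,u+n}Y(u,x)v\,x^{-2n-2}$, $O_n(V)=\{(L(-1)+L(0))v\}+\mathrm{span}\{u\circ_nv\}$, $A_n(V)=V/O_n(V)$ with product $u*_nv=\sum_{m=0}^n(-1)^m\binom{m+n}{n}\mathrm{Res}_x(1+x)^{\mathrm{wt}\,u+n}Y(u,x)v\,x^{-n-m-1}$.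 *)

theory Defs
  imports Complex_Main
begin

text \<open>
  Scalars are complex numbers; a complex vector space is a type 'v::ab_group_add
  together with a scalar multiplication sc satisfying the vector_space axioms.
  A state-field correspondence is encoded by its modes:
  Y u k v = u_(k) v, i.e. Y(u,x) v = sum over k of (u_(k) v) x^(-k-1).
\<close>

definition fsum :: "(nat \<Rightarrow> 'v::ab_group_add) \<Rightarrow> 'v" where
  "fsum f = (if finite {i. f i \<noteq> 0} then (\<Sum>i\<in>{i. f i \<noteq> 0}. f i) else 0)"

text \<open>Virasoro operators: Y(omega,x) = sum L(m) x^(-m-2), i.e. L(m) = omega_(m+1).\<close>
definition vL :: "('v \<Rightarrow> int \<Rightarrow> 'v \<Rightarrow> 'v) \<Rightarrow> 'v \<Rightarrow> int \<Rightarrow> 'v \<Rightarrow> 'v" where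
  "vL Y om m = Y om (m + 1)"

definition pbw :: "('v \<Rightarrow> int \<Rightarrow> 'v \<Rightarrow> 'v) \<Rightarrow> 'v \<Rightarrow> 'v \<Rightarrow> nat list \<Rightarrow> 'v" where
  "pbw Y om vac ms = foldr (\<lambda>m v. vL Y om (- int m) v) ms vac"

definition pbw_lists :: "nat list set" where
  "pbw_lists = {ms. sorted_wrt (\<ge>) ms \<and> (\<forall>m\<in>set ms. 2 \<le> m)}"

text \<open>
  The structure (V, Y, 1, omega) is (isomorphic to) the Virasoro vertex operator
  algebra V_Vir(c,0): a vertex operator algebra (vector space, bilinear modes,
  truncation, vacuum axioms, Borcherds/Jacobi identity, L(-1)-derivative property),
  whose conformal vector omega has Virasoro modes of central charge c, and in which
  the vectors L(-m_1)...L(-m_k) 1 (m_1 \<ge> ... \<ge> m_k \<ge> 2) are pairwise distinct and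
  form a basis (PBW basis of M(c,0)/<L(-1)1>).  These conditions determine the
  vertex operator algebra V_Vir(c,0) up to isomorphism.
\<close>
definition vir_voa ::
  "(complex \<Rightarrow> 'v::ab_group_add \<Rightarrow> 'v) \<Rightarrow> ('v \<Rightarrow> int \<Rightarrow> 'v \<Rightarrow> 'v) \<Rightarrow> 'v \<Rightarrow> 'v \<Rightarrow> complex \<Rightarrow> bool"
  where
  "vir_voa sc Y vac om c \<longleftrightarrow>
     Vector_Spaces.vector_space sc \<and>
     (\<forall>u k. Vector_Spaces.linear sc sc (Y u k)) \<and>
     (\<forall>v k. Vector_Spaces.linear sc sc (\<lambda>u. Y u k v)) \<and>
     (\<forall>u v. \<exists>N. \<forall>k\<ge>N. Y u k v = 0) \<and>
     (\<forall>k v. Y vac k v = (if k = -1 then v else 0)) \<and>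
     (\<forall>u k. k \<ge> 0 \<longrightarrow> Y u k vac = 0) \<and>
     (\<forall>u. Y u (-1) vac = u) \<and>
     (\<forall>p q r u v w.
        fsum (\<lambda>i. sc (of_int p gchoose i) (Y (Y u (r + int i) v) (p + q - int i) w)) =
        fsum (\<lambda>i. sc ((-1) ^ i * (of_int r gchoose i)) (Y u (p + r - int i) (Y v (q + int i) w)))
        - sc (if even r then 1 else -1)
            (fsum (\<lambda>i. sc ((-1) ^ i * (of_int r gchoose i)) (Y v (q + r - int i) (Y u (p + int i) w))))) \<and>
     (\<forall>m p v. vL Y om m (vL Y om p v) - vL Y om p (vL Y om m v) =
        sc (of_int (m - p)) (vL Y om (m + p) v) +
        (if m + p = 0 then sc (of_int (m ^ 3 - m) / 12 * c) v else 0)) \<and>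
     (\<forall>u k v. Y (vL Y om (-1) u) k v = sc (- of_int k) (Y u (k - 1) v)) \<and>
     inj_on (pbw Y om vac) pbw_lists \<and>
     \<not> module.dependent sc (pbw Y om vac ` pbw_lists) \<and>
     module.span sc (pbw Y om vac ` pbw_lists) = UNIV"

text \<open>Homogeneous of weight w: L(0) u = w u (weights of V_Vir(c,0) are natural numbers).\<close>
definition homog :: "(complex \<Rightarrow> 'v \<Rightarrow> 'v) \<Rightarrow> ('v \<Rightarrow> int \<Rightarrow> 'v \<Rightarrow> 'v) \<Rightarrow> 'v \<Rightarrow> nat \<Rightarrow> 'v \<Rightarrow> bool" where
  "homog sc Y om w u \<longleftrightarrow> vL Y om 0 u = sc (of_nat w) u"

text \<open>
  u \<circ>_n v = Res_x (1+x)^(wt u + n) Y(u,x) v x^(-2n-2)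
           = sum_{j=0}^{wt u + n} binom(wt u + n, j) u_(j-2n-2) v,
  for u homogeneous of weight w.
\<close>
definition circ_n :: "(complex \<Rightarrow> 'v::ab_group_add \<Rightarrow> 'v) \<Rightarrow> ('v \<Rightarrow> int \<Rightarrow> 'v \<Rightarrow> 'v) \<Rightarrow> nat \<Rightarrow> nat \<Rightarrow> 'v \<Rightarrow> 'v \<Rightarrow> 'v" where
  "circ_n sc Y n w u v = (\<Sum>j\<le>w + n. sc (of_nat ((w + n) choose j)) (Y u (int j - 2 * int n - 2) v))"

definition O_n :: "(complex \<Rightarrow> 'v::ab_group_add \<Rightarrow> 'v) \<Rightarrow> ('v \<Rightarrow> int \<Rightarrow> 'v \<Rightarrow> 'v) \<Rightarrow> 'v \<Rightarrow> nat \<Rightarrow> 'v set" where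
  "O_n sc Y om n = module.span sc
     ({vL Y om (-1) v + vL Y om 0 v | v. True} \<union>
      {circ_n sc Y n w u v | w u v. homog sc Y om w u})"

text \<open>
  u *_n v = sum_{m=0}^n (-1)^m binom(m+n,n) Res_x (1+x)^(wt u+n) Y(u,x) v x^(-n-m-1)
          = sum_{m=0}^n sum_{j=0}^{wt u+n} (-1)^m binom(m+n,n) binom(wt u+n,j) u_(j-n-m-1) v,
  for u homogeneous of weight w.
\<close>
definition star_h :: "(complex \<Rightarrow> 'v::ab_group_add \<Rightarrow> 'v) \<Rightarrow> ('v \<Rightarrow> int \<Rightarrow> 'v \<Rightarrow> 'v) \<Rightarrow> nat \<Rightarrow> nat \<Rightarrow> 'v \<Rightarrow> 'v \<Rightarrow> 'v" where
  "star_h sc Y n w u v = (\<Sum>m\<le>n. \<Sum>j\<le>w + n.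
     sc ((-1) ^ m * of_nat ((m + n) choose n) * of_nat ((w + n) choose j))
        (Y u (int j - int n - int m - 1) v))"

definition wdecomp :: "(complex \<Rightarrow> 'v::ab_group_add \<Rightarrow> 'v) \<Rightarrow> ('v \<Rightarrow> int \<Rightarrow> 'v \<Rightarrow> 'v) \<Rightarrow> 'v \<Rightarrow> 'v \<Rightarrow> (nat \<Rightarrow> 'v) \<Rightarrow> bool" where
  "wdecomp sc Y om u f \<longleftrightarrow> finite {k. f k \<noteq> 0} \<and> (\<forall>k. homog sc Y om k (f k)) \<and>
     u = (\<Sum>k\<in>{k. f k \<noteq> 0}. f k)"

definition wcomp :: "(complex \<Rightarrow> 'v::ab_group_add \<Rightarrow> 'v) \<Rightarrow> ('v \<Rightarrow> int \<Rightarrow> 'v \<Rightarrow> 'v) \<Rightarrow> 'v \<Rightarrow> nat \<Rightarrow> 'v \<Rightarrow> 'v" where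
  "wcomp sc Y om k u = (THE f. wdecomp sc Y om u f) k"

definition star_n :: "(complex \<Rightarrow> 'v::ab_group_add \<Rightarrow> 'v) \<Rightarrow> ('v \<Rightarrow> int \<Rightarrow> 'v \<Rightarrow> 'v) \<Rightarrow> 'v \<Rightarrow> nat \<Rightarrow> 'v \<Rightarrow> 'v \<Rightarrow> 'v" where
  "star_n sc Y om n u v =
     (\<Sum>k\<in>{k. wcomp sc Y om k u \<noteq> 0}. star_h sc Y n k (wcomp sc Y om k u) v)"

definition vir_word :: "('v \<Rightarrow> int \<Rightarrow> 'v \<Rightarrow> 'v) \<Rightarrow> 'v \<Rightarrow> 'v \<Rightarrow> (nat \<Rightarrow> nat) \<Rightarrow> nat \<Rightarrow> 'v" where
  "vir_word Y om vac i N = fold (\<lambda>k v. (vL Y om (- int k) ^^ i k) v) [2..<N + 1] vac"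

definition gens_n :: "('v \<Rightarrow> int \<Rightarrow> 'v \<Rightarrow> 'v) \<Rightarrow> 'v \<Rightarrow> 'v \<Rightarrow> nat \<Rightarrow> 'v set" where
  "gens_n Y om vac n =
     {vir_word Y om vac i (2 * n + 1) | i. 2 * i 2 \<le> n} \<union>
     {(vL Y om (-2) ^^ j) vac | j. 1 \<le> j}"

text \<open>
  Preimage in V of the subalgebra of A_n(V) generated by S + O_n(V): the smallest
  subspace containing O_n(V) and S that is closed under *_n.
\<close>
definition gen_subalg :: "(complex \<Rightarrow> 'v::ab_group_add \<Rightarrow> 'v) \<Rightarrow> ('v \<Rightarrow> int \<Rightarrow> 'v \<Rightarrow> 'v) \<Rightarrow> 'v \<Rightarrow> nat \<Rightarrow> 'v set \<Rightarrow> 'v set" where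
  "gen_subalg sc Y om n S = \<Inter>{W. module.subspace sc W \<and> O_n sc Y om n \<subseteq> W \<and> S \<subseteq> W \<and>
       (\<forall>u\<in>W. \<forall>v\<in>W. star_n sc Y om n u v \<in> W)}"

end

theory Submission
  imports Defs
    "HOL-Computational_Algebra.Formal_Power_Series"
    "HOL-Computational_Algebra.Polynomial"
    "HOL-Library.Multiset"
begin

text \<open>
  Let \<open>W\<close> be a subspace closed under \<open>*\<^sub>n\<close> that contains \<open>O\<^sub>n(V)\<close> and the generators.  Filter \<open>V\<close> by
  the number of factors \<open>L(-m)\<close> and suppose that all vectors of length \<open>< d\<close> lie in \<open>W\<close>; then
  the \<open>L(-m)\<close> commute modulo \<open>W\<close> in words of length \<open>d\<close>.  Write \<open>y(x)\<close> for the regular part of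
  \<open>Y(\<omega>,x)\<close>.  The relations given by \<open>\<omega> *\<^sub>n v\<close> and by \<open>L(-p-2)1 \<circ>\<^sub>n v\<close> say that, modulo \<open>W\<close>,
  \<open>y(x) = \<Sum>\<^sub>k (1+x)\<^bsup>k-2\<^esup> B\<^sub>k\<close>, where \<open>k\<close> runs over the integers with \<open>1 \<le> \<bar>k\<bar> \<le> n\<close> and \<open>B\<^sub>k\<close> is a linear
  combination of \<open>L(-2), \<dots>, L(-2n-1)\<close>.  For a word \<open>u\<close> of length \<open>r\<close> the product \<open>u \<circ>\<^sub>n v\<close> then
  becomes a sum of terms \<open>B\<^bsub>k\<^sub>1\<^esub> \<cdots> B\<^bsub>k\<^sub>r\<^esub> v\<close> with the coefficient \<open>binom(k\<^sub>1 + \<cdots> + k\<^sub>r + n, 2n+1)\<close>, so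
  every product of \<open>B\<close>'s that contains factors whose indices add up to more than \<open>n\<close> in absolute value lies in \<open>W\<close>.
  If \<open>n \<ge> 2\<close>, only \<open>B\<^sub>2\<close> involves \<open>L(-2)\<close>, because \<open>(1+x)\<^bsup>k-2\<^esup> = 1\<close> for \<open>k = 2\<close>.  Hence a product of \<open>B\<close>'s
  either has more than \<open>n/2\<close> factors \<open>B\<^sub>2\<close> and lies in \<open>W\<close>, or it is a combination of the generators.
  If \<open>n = 1\<close>, a product with a repeated factor lies in \<open>W\<close>, which leaves words of length at most two.
\<close>

subsection \<open>Newton interpolation and binomial identities\<close>

definition gchoose_poly :: "complex \<Rightarrow> nat \<Rightarrow> complex poly" where
  "gchoose_poly a e = smult (1 / fact e) (\<Prod>i<e. [:- (a + of_nat i), 1:])"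

lemma poly_gchoose_poly [simp]: "poly (gchoose_poly a e) x = (x - a) gchoose e"
  by (simp add: gchoose_poly_def poly_prod gbinomial_prod_rev atLeast0LessThan algebra_simps)

lemma degree_gchoose_poly [simp]: "degree (gchoose_poly a e) = e"
proof -
  have "degree (\<Prod>i<e. [:- (a + of_nat i), 1:]) = e"
    by (subst degree_prod_eq_sum_degree) auto
  then show ?thesis
    by (simp add: gchoose_poly_def)
qed

lemma coeff_gchoose_poly_nonzero: "coeff (gchoose_poly a e) e \<noteq> 0"
proof -
  have "poly (gchoose_poly a e) (a + of_nat e) = 1"
    using binomial_gbinomial[of e e, where ?'a = complex] by simp
  then have "gchoose_poly a e \<noteq> 0" by (metis poly_0 zero_neq_one)
  then show ?thesis
    using leading_coeff_0_iff[of "gchoose_poly a e"] by simp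
qed

text \<open>Since \<open>gchoose_poly a N\<close> has degree exactly \<open>N\<close>, a multiple of
  it removes the top coefficient, which lowers the degree bound.\<close>

lemma newton_expansion:
  fixes a :: complex
  assumes "p = 0 \<or> degree p < N"
  shows "\<exists>b. \<forall>x. poly p x = (\<Sum>e<N. b e * ((x - a) gchoose e))"
  using assms
proof (induction N arbitrary: p)
  case 0
  then show ?case by simp
next
  case (Suc N)
  let ?q = "gchoose_poly a N"
  define t where "t = coeff p N / coeff ?q N"
  have t: "coeff (p - smult t ?q) N = 0"
    using coeff_gchoose_poly_nonzero by (simp add: t_def)
  have "degree (p - smult t ?q) \<le> N"
    using Suc.prems by (intro degree_diff_le) (auto intro: le_trans[OF degree_smult_le])
  then have "p - smult t ?q = 0 \<or> degree (p - smult t ?q) < N"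
    using t by (metis leading_coeff_0_iff le_neq_implies_less)
  then obtain b where b: "\<And>x. poly (p - smult t ?q) x = (\<Sum>e<N. b e * ((x - a) gchoose e))"
    using Suc.IH by blast
  have "poly p x = (\<Sum>e<Suc N. (b(N := t)) e * ((x - a) gchoose e))" for x
    using b[of x] by (simp add: algebra_simps)
  then show ?case by blast
qed

text \<open>A polynomial of degree below \<open>N\<close> with at least \<open>N\<close> roots is
  zero. Its top coefficient comes from the last summand alone, so the coefficients can be peeled off
  from the top.\<close>

lemma newton_coeffs_zero:
  fixes K :: "complex set"
  assumes "finite K" "card K \<ge> N" "\<And>k. k \<in> K \<Longrightarrow> (\<Sum>e<N. b e * ((k - a) gchoose e)) = 0" "e < N"
  shows "b e = 0"
  using assms(2-4)
proof (induction N)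
  case (Suc N)
  define p where "p = (\<Sum>e<Suc N. smult (b e) (gchoose_poly a e))"
  have "degree p < Suc N"
    unfolding p_def by (intro degree_sum_less) (auto intro: le_less_trans[OF degree_smult_le])
  moreover have "poly p k = 0" if "k \<in> K" for k
    using Suc.prems(2)[OF that] by (simp add: p_def poly_sum)
  ultimately have "p = 0"
    using Suc.prems(1) card_mono[OF poly_roots_finite, of p K] card_poly_roots_bound[of p]
    by (metis (mono_tags, lifting) leD le_less_trans less_le_trans mem_Collect_eq subsetI)
  then have "coeff p N = 0" by simp
  then have N: "b N = 0"
    using coeff_gchoose_poly_nonzero by (simp add: p_def coeff_sum coeff_eq_0)
  show ?case
    using Suc.IH Suc.prems N by (cases "e = N") auto
qed simp

text \<open>The square matrix with entries \<open>(k - a) gchoose e\<close> is invertible, and the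
  two halves say that \<open>b\<close> inverts it from either side. The rows of the inverse are the
  Newton coefficients of the Lagrange polynomials of \<open>K\<close>.\<close>

lemma newton_dual_basis:
  fixes K :: "complex set"
  assumes "finite K"
  shows "\<exists>b. (\<forall>k\<in>K. \<forall>k'\<in>K. (\<Sum>e<card K. b k e * ((k' - a) gchoose e)) = (if k' = k then 1 else 0)) \<and>
    (\<forall>e<card K. \<forall>e'<card K. (\<Sum>k\<in>K. ((k - a) gchoose e) * b k e') = (if e' = e then 1 else 0))"
proof -
  have "\<exists>b. \<forall>k'\<in>K. (\<Sum>e<card K. b e * ((k' - a) gchoose e)) = (if k' = k then 1 else 0)" if "k \<in> K" for k
  proof -
    \<comment> \<open>The Lagrange polynomial of the point \<open>k\<close>.\<close>
    define p where "p = (\<Prod>i\<in>K - {k}. smult (1 / (k - i)) [:- i, 1:])"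
    have "degree p \<le> (\<Sum>i\<in>K - {k}. degree (smult (1 / (k - i)) [:- i, 1:]))"
      unfolding p_def by (rule degree_prod_sum_le[unfolded comp_def]) (use assms in simp)
    also have "\<dots> \<le> card (K - {k})"
      using sum_bounded_above[of "K - {k}" "\<lambda>i. degree (smult (1 / (k - i)) [:- i, 1:])" 1]
        le_trans[OF degree_smult_le] by simp
    also have "\<dots> < card K"
      using assms that by (rule card_Diff1_less)
    finally obtain b where b: "\<And>x. poly p x = (\<Sum>e<card K. b e * ((x - a) gchoose e))"
      using newton_expansion[of p "card K" a] by blast
    have "poly p k' = (if k' = k then 1 else 0)" if "k' \<in> K" for k'
    proof (cases "k' = k")
      case True
      then show ?thesis by (auto simp: p_def poly_prod diff_divide_distrib[symmetric]
          intro!: prod.neutral split: if_splits)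
    next
      case False
      then have "poly p k' = 0"
        unfolding p_def poly_prod using assms that by (intro prod_zero) auto
      then show ?thesis using False by simp
    qed
    then show ?thesis
      unfolding b by (intro exI[of _ b] ballI)
  qed
  then obtain b where b: "\<And>k k'. k \<in> K \<Longrightarrow> k' \<in> K \<Longrightarrow>
      (\<Sum>e<card K. b k e * ((k' - a) gchoose e)) = (if k' = k then 1 else 0)"
    by metis
  have "(\<Sum>k\<in>K. ((k - a) gchoose e) * b k e') = (if e' = e then 1 else 0)"
    if e: "e < card K" "e' < card K" for e e'
  proof -
    \<comment> \<open>For fixed \<open>e\<close>, the Newton series with coefficients
      \<open>d\<close> vanishes on all of \<open>K\<close>, so uniqueness of the coefficients turns
      the one-sided inverse into a two-sided one.\<close>
    define d where "d = (\<lambda>e'. (\<Sum>k\<in>K. ((k - a) gchoose e) * b k e') - (if e' = e then 1 else 0))"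
    have "(\<Sum>e'<card K. d e' * ((k' - a) gchoose e')) = 0" if "k' \<in> K" for k'
    proof -
      have "(\<Sum>e'<card K. (\<Sum>k\<in>K. ((k - a) gchoose e) * b k e') * ((k' - a) gchoose e'))
        = (\<Sum>k\<in>K. ((k - a) gchoose e) * (\<Sum>e'<card K. b k e' * ((k' - a) gchoose e')))"
        unfolding sum_distrib_right sum_distrib_left by (subst sum.swap) (simp add: mult_ac)
      also have "\<dots> = (\<Sum>k\<in>K. if k' = k then (k - a) gchoose e else 0)"
        by (rule sum.cong) (auto simp: b that)
      also have "\<dots> = (k' - a) gchoose e"
        using assms that by simp
      moreover have "(\<Sum>e'<card K. (if e' = e then 1 else 0) * ((k' - a) gchoose e')) = (k' - a) gchoose e"
        using e by (simp add: if_distrib[of "\<lambda>x. x * _"] sum.delta cong: if_cong)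
      ultimately show ?thesis
        by (simp add: d_def left_diff_distrib sum_subtractf)
    qed
    then have "d e' = 0"
      using newton_coeffs_zero[OF assms order_refl, of d a e'] e by blast
    then show ?thesis by (simp add: d_def)
  qed
  then show ?thesis using b by blast
qed

lemma gbinomial_vandermonde_le: "(\<Sum>j\<le>l. (a gchoose j) * (b gchoose (l - j))) = ((a + b :: complex) gchoose l)"
  using gbinomial_Vandermonde[of a b l] by (simp add: atLeast0AtMost)

text \<open>Both sides are the coefficient of x^i in the \<open>e\<close>-th divided derivative of
  (1+x)^a.\<close>

lemma gbinomial_iterated: "of_nat ((e + i) choose i) * ((a::complex) gchoose (e + i)) = (a gchoose e) * ((a - of_nat e) gchoose i)"
  using gbinomial_trinomial_revision[of e "e + i" a] binomial_symmetric[of i "e + i"]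
  by (simp add: binomial_gbinomial mult.commute)

lemma gbinomial_of_int_zero:
  assumes "0 \<le> k" "k < int l"
  shows "(of_int k :: complex) gchoose l = 0"
proof -
  have "(of_int k :: complex) = of_nat (nat k)" using assms by simp
  moreover have "nat k < l" using assms by linarith
  ultimately show ?thesis using binomial_gbinomial[of "nat k" l, where ?'a = complex] by (simp add: binomial_eq_0)
qed

text \<open>The factor \<open>(k + n) gchoose n\<close> splits off and is zero for negative
  \<open>k\<close>; the remaining alternating sum is, up to sign, \<open>(k - 1) gchoose n\<close>,
  which is zero for positive \<open>k\<close>. This makes (1+x)^(k-2) a solution of the relation
  coming from omega *_n v.\<close>

lemma star_kernel_zero:
  assumes "k \<noteq> 0" "\<bar>k\<bar> \<le> int n"
  shows "(\<Sum>m\<le>n. (-1) ^ m * of_nat ((m + n) choose n) * (of_int k + of_nat n gchoose (n + m))) = (0::complex)"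
proof -
  have "of_nat ((m + n) choose n) * (of_int k + of_nat n gchoose (n + m)) =
    (of_int k + of_nat n gchoose n) * (of_int k gchoose m :: complex)" for m
    using gbinomial_iterated[of n m "of_int k + of_nat n"] binomial_symmetric[of n "m + n"]
    by (simp add: add.commute)
  then have "(\<Sum>m\<le>n. (-1) ^ m * of_nat ((m + n) choose n) * (of_int k + of_nat n gchoose (n + m))) =
     (of_int k + of_nat n gchoose n) * (\<Sum>m\<le>n. (of_int k gchoose m) * (-1) ^ m :: complex)"
    by (simp add: sum_distrib_left mult_ac)
  also have "\<dots> = (of_int (k + int n) gchoose n) * ((-1) ^ n * (of_int (k - 1) gchoose n))"
    by (simp add: gbinomial_sum_lower_neg)
  also have "\<dots> = 0"
  proof (cases "k > 0")
    case True
    then have "(of_int (k - 1) :: complex) gchoose n = 0"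
      using assms by (intro gbinomial_of_int_zero) auto
    then show ?thesis by simp
  next
    case False
    then have "(of_int (k + int n) :: complex) gchoose n = 0"
      using assms by (intro gbinomial_of_int_zero) auto
    then show ?thesis by simp
  qed
  finally show ?thesis .
qed

subsection \<open>The length filtration\<close>

lemma fsum_eq_sum:
  assumes "\<And>i. i \<ge> N \<Longrightarrow> f i = 0"
  shows "fsum f = (\<Sum>i<N. f i)"
proof -
  have sub: "{i. f i \<noteq> 0} \<subseteq> {..<N}"
    using assms by (metis (mono_tags, lifting) lessThan_iff mem_Collect_eq not_le subsetI)
  then have "finite {i. f i \<noteq> 0}"
    by (rule finite_subset) simp
  then show ?thesis
    unfolding fsum_def by (auto intro!: sum.mono_neutral_left sub)
qed

section \<open>Axioms and special cases of the Borcherds identity\<close>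

locale virasoro_voa = vector_space sc
  for sc :: "complex \<Rightarrow> 'v::ab_group_add \<Rightarrow> 'v" +
  fixes Y :: "'v \<Rightarrow> int \<Rightarrow> 'v \<Rightarrow> 'v" and vac om :: 'v and c :: complex
  assumes voa: "vir_voa sc Y vac om c"
begin

lemmas voa_conjs = voa[unfolded vir_voa_def, THEN conjunct2]

lemma Y_right_linear: "Vector_Spaces.linear sc sc (Y u k)"
  using voa_conjs[THEN conjunct1] by blast

lemma Y_left_linear: "Vector_Spaces.linear sc sc (\<lambda>u. Y u k v)"
  using voa_conjs[THEN conjunct2, THEN conjunct1] by blast

lemmas Y_right_simps = module_hom.add[OF Y_right_linear[unfolded linear_iff_module_hom]]
  module_hom.scale[OF Y_right_linear[unfolded linear_iff_module_hom]]
  module_hom.zero[OF Y_right_linear[unfolded linear_iff_module_hom]]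
  module_hom.diff[OF Y_right_linear[unfolded linear_iff_module_hom]]
  module_hom.neg[OF Y_right_linear[unfolded linear_iff_module_hom]]
  module_hom.sum[OF Y_right_linear[unfolded linear_iff_module_hom]]

lemmas Y_left_simps = module_hom.add[OF Y_left_linear[unfolded linear_iff_module_hom]]
  module_hom.scale[OF Y_left_linear[unfolded linear_iff_module_hom]]
  module_hom.zero[OF Y_left_linear[unfolded linear_iff_module_hom]]

lemma truncation: "\<exists>N. \<forall>k\<ge>N. Y u k v = 0"
  using voa_conjs[THEN conjunct2, THEN conjunct2, THEN conjunct1] by blast

lemma Y_vac: "Y vac k v = (if k = -1 then v else 0)"
  using voa_conjs[THEN conjunct2, THEN conjunct2, THEN conjunct2, THEN conjunct1] by blast

lemma Y_creation: "k \<ge> 0 \<Longrightarrow> Y u k vac = 0"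
  using voa_conjs[THEN conjunct2, THEN conjunct2, THEN conjunct2, THEN conjunct2, THEN conjunct1] by blast

lemma Y_creation_minus_one: "Y u (-1) vac = u"
  using voa_conjs[THEN conjunct2, THEN conjunct2, THEN conjunct2, THEN conjunct2, THEN conjunct2, THEN conjunct1] by blast

lemma borcherds: "fsum (\<lambda>i. sc (of_int p gchoose i) (Y (Y u (r + int i) v) (p + q - int i) w)) =
        fsum (\<lambda>i. sc ((-1) ^ i * (of_int r gchoose i)) (Y u (p + r - int i) (Y v (q + int i) w)))
        - sc (if even r then 1 else -1)
            (fsum (\<lambda>i. sc ((-1) ^ i * (of_int r gchoose i)) (Y v (q + r - int i) (Y u (p + int i) w))))"
  using voa_conjs[THEN conjunct2, THEN conjunct2, THEN conjunct2, THEN conjunct2, THEN conjunct2, THEN conjunct2, THEN conjunct1] by blast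

lemma virasoro: "vL Y om m (vL Y om p v) - vL Y om p (vL Y om m v) =
        sc (of_int (m - p)) (vL Y om (m + p) v) +
        (if m + p = 0 then sc (of_int (m ^ 3 - m) / 12 * c) v else 0)"
  using voa_conjs[THEN conjunct2, THEN conjunct2, THEN conjunct2, THEN conjunct2, THEN conjunct2, THEN conjunct2, THEN conjunct2, THEN conjunct1] by blast

lemma pbw_independent: "independent (pbw Y om vac ` pbw_lists)"
  and pbw_span: "span (pbw Y om vac ` pbw_lists) = UNIV"
  using voa_conjs[THEN conjunct2, THEN conjunct2, THEN conjunct2, THEN conjunct2, THEN conjunct2, THEN conjunct2, THEN conjunct2, THEN conjunct2, THEN conjunct2] by auto

lemma fsum_mem:
  assumes "subspace S" "\<And>i. f i \<in> S"
  shows "fsum f \<in> S"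
  unfolding fsum_def using assms by (auto intro: subspace_sum subspace_0)

lemma fsum_diff_mem:
  assumes S: "subspace S" and "\<And>i. i > l \<Longrightarrow> f i \<in> S" and "\<And>i. i \<ge> N \<Longrightarrow> f i = 0"
  shows "fsum f - (\<Sum>i\<le>l. f i) \<in> S"
proof -
  have "fsum f = (\<Sum>i<max N (Suc l). f i)"
    using assms by (intro fsum_eq_sum) auto
  also have "\<dots> = (\<Sum>i\<le>l. f i) + (\<Sum>i\<in>{Suc l..<max N (Suc l)}. f i)"
    by (subst sum.union_disjoint[symmetric]) (auto intro!: sum.cong)
  finally show ?thesis
    using assms by (auto intro!: subspace_sum)
qed

lemma diff_trans: "subspace S \<Longrightarrow> x - y \<in> S \<Longrightarrow> y - z \<in> S \<Longrightarrow> x - z \<in> S"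
  using subspace_add[of S "x - y" "y - z"] by simp

lemma diff_mem_iff: "subspace S \<Longrightarrow> x - y \<in> S \<Longrightarrow> x \<in> S \<longleftrightarrow> y \<in> S"
  by (metis add.commute add_diff_cancel diff_add_cancel subspace_add subspace_diff)

text \<open>The case \<open>r = 0\<close>, in which only \<open>i = 0\<close> survives in the two
  sums on the right of \<open>borcherds\<close>.\<close>

lemma borcherds_commutator:
  "Y u p (Y v q w) - Y v q (Y u p w) =
    fsum (\<lambda>i. sc (of_int p gchoose i) (Y (Y u (int i) v) (p + q - int i) w))"
proof -
  have 0: "(0::complex) gchoose i = (if i = 0 then 1 else 0)" for i
    by (rule gbinomial_0_left)
  have "fsum (\<lambda>i. sc ((-1) ^ i * (of_int 0 gchoose i)) (f i)) = f 0" for f :: "nat \<Rightarrow> 'v"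
    by (subst fsum_eq_sum[of 1]) (auto simp: 0)
  from this[of "\<lambda>i. Y u (p - int i) (Y v (q + int i) w)"]
    this[of "\<lambda>i. Y v (q - int i) (Y u (p + int i) w)"]
  show ?thesis
    using borcherds[of p u 0 v q w] by simp
qed

text \<open>The case \<open>p = 0\<close>, in which only \<open>i = 0\<close> survives on the left
  of \<open>borcherds\<close>.\<close>

lemma borcherds_associator:
  "Y (Y u r v) q w =
    fsum (\<lambda>i. sc ((-1) ^ i * (of_int r gchoose i)) (Y u (r - int i) (Y v (q + int i) w)))
    - sc (if even r then 1 else -1)
        (fsum (\<lambda>i. sc ((-1) ^ i * (of_int r gchoose i)) (Y v (q + r - int i) (Y u (int i) w))))"
proof -
  have 0: "(0::complex) gchoose i = (if i = 0 then 1 else 0)" for i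
    by (rule gbinomial_0_left)
  have "fsum (\<lambda>i. sc (of_int 0 gchoose i) (f i)) = f 0" for f :: "nat \<Rightarrow> 'v"
    by (subst fsum_eq_sum[of 1]) (auto simp: 0)
  from this[of "\<lambda>i. Y (Y u (r + int i) v) (q - int i) w"] show ?thesis
    using borcherds[of 0 u r v q w] by simp
qed

lemma Y_left_span_mem:
  assumes "u \<in> span S" "subspace T" "\<And>s. s \<in> S \<Longrightarrow> Y s k v \<in> T"
  shows "Y u k v \<in> T"
  using assms(1)
proof (rule span_induct)
  show "subspace {u. Y u k v \<in> T}"
    using assms(2) by (auto simp: subspace_def Y_left_simps)
qed (use assms in auto)

lemma Y_right_span_mem:
  assumes "v \<in> span S" "subspace T" "\<And>s. s \<in> S \<Longrightarrow> Y u k s \<in> T"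
  shows "Y u k v \<in> T"
  using assms(1)
proof (rule span_induct)
  show "subspace {v. Y u k v \<in> T}"
    using assms(2) by (auto simp: subspace_def Y_right_simps)
qed (use assms in auto)

section \<open>Words in the Virasoro operators and their length\<close>

text \<open>\<open>y e\<close> is \<open>L(-e-2)\<close>, the coefficient of \<open>x\<^sup>e\<close> in \<open>Y(\<omega>,x)\<close>; words need not be ordered.\<close>
definition y :: "nat \<Rightarrow> 'v \<Rightarrow> 'v" where
  "y e = Y om (- int e - 1)"

definition word :: "nat list \<Rightarrow> 'v" where
  "word es = foldr y es vac"

lemma word_simps [simp]: "word [] = vac" "word (e # es) = y e (word es)"
  by (simp_all add: word_def)

text \<open>The bound on the length is strict, so that \<open>G 0 = {0}\<close> and the nonnegative modes of a word of
  length \<open>r\<close> map \<open>G (s + 1)\<close> into \<open>G (r + s)\<close>.\<close>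
definition G :: "nat \<Rightarrow> 'v set" where
  "G d = span {word es | es. length es < d}"

lemma subspace_G [simp]: "subspace (G d)"
  by (simp add: G_def)

lemma word_G: "length es < d \<Longrightarrow> word es \<in> G d"
  unfolding G_def by (rule span_base) auto

lemma G_mono: "d \<le> d' \<Longrightarrow> v \<in> G d \<Longrightarrow> v \<in> G d'"
  unfolding G_def using span_mono[of "{word es | es. length es < d}" "{word es | es. length es < d'}"]
  by force

lemma y_simps: "y e (u + v) = y e u + y e v" "y e (sc a v) = sc a (y e v)" "y e 0 = 0"
  "y e (u - v) = y e u - y e v" "y e (sum f A) = (\<Sum>a\<in>A. y e (f a))"
  by (simp_all add: y_def Y_right_simps)

lemma y_G: "v \<in> G d \<Longrightarrow> y e v \<in> G (Suc d)"
  unfolding y_def G_def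
proof (rule Y_right_span_mem)
  fix s assume "s \<in> {word es |es. length es < d}"
  then obtain es where "s = word es" "length es < d" by auto
  then have "Y om (- int e - 1) s = word (e # es)"
    by (simp add: y_def)
  then show "Y om (- int e - 1) s \<in> span {word es |es. length es < Suc d}"
    using \<open>length es < d\<close> by (intro span_base) (metis (mono_tags, lifting) Suc_less_eq length_Cons mem_Collect_eq)
qed auto

lemma om_commutator:
  "Y om p (Y om q v) - Y om q (Y om p v) =
    sc (of_int (p - q)) (Y om (p + q - 1) v) +
    (if p + q = 2 then sc (of_int ((p - 1) ^ 3 - (p - 1)) / 12 * c) v else 0)"
  using virasoro[of "p - 1" "q - 1" v] by (simp add: vL_def algebra_simps)

text \<open>A nonnegative mode kills \<open>vac\<close>. Passing it through a letter
  \<open>y e\<close> yields, besides a scalar, the mode \<open>q - e - 2\<close>, which is either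
  again nonnegative or a single letter replacing \<open>y e\<close>.\<close>

lemma Y_om_nonneg_G:
  assumes "v \<in> G d" "q \<ge> 0"
  shows "Y om q v \<in> G d"
proof -
  have *: "Y om q (word es) \<in> G (Suc (length es))" if "q \<ge> 0" for es q
    using that
  proof (induction es arbitrary: q)
    case Nil
    then show ?case by (simp add: Y_creation subspace_0)
  next
    case (Cons e es)
    let ?w = "word es" and ?S = "G (Suc (length (e # es)))"
    have "Y om (q - int e - 2) ?w \<in> ?S"
    proof (cases "q - int e - 2 \<ge> 0")
      case True
      then show ?thesis
        using Cons.IH[of "q - int e - 2"] G_mono[of "Suc (length es)" "Suc (length (e # es))"] by auto
    next
      case False
      then have "Y om (q - int e - 2) ?w = y (nat (int e + 1 - q)) ?w"
        by (simp add: y_def)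
      then show ?thesis
        using y_G[OF word_G] by simp
    qed
    moreover have "?w \<in> ?S"
      by (rule word_G) simp
    moreover have "y e (Y om q ?w) \<in> ?S"
      using y_G[OF Cons.IH[OF Cons.prems]] by simp
    moreover have "Y om q (word (e # es)) = y e (Y om q ?w) +
      (sc (of_int (q - (- int e - 1))) (Y om (q - int e - 2) ?w) +
       (if q + (- int e - 1) = 2 then sc (of_int ((q - 1) ^ 3 - (q - 1)) / 12 * c) ?w else 0))"
      using om_commutator[of q "- int e - 1" ?w] by (simp add: y_def algebra_simps)
    ultimately show ?case
      by (auto intro!: subspace_add[OF subspace_G] subspace_scale[OF subspace_G] subspace_0[OF subspace_G]
          simp del: word_simps)
  qed
  show ?thesis
    using assms(1) unfolding G_def
  proof (rule Y_right_span_mem)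
    fix s assume "s \<in> {word es |es. length es < d}"
    then obtain es where "s = word es" "length es < d" by auto
    then show "Y om q s \<in> span {word es |es. length es < d}"
      using *[OF assms(2), of es] G_mono[of "Suc (length es)" d] unfolding G_def by auto
  qed auto
qed

text \<open>The commutator of two letters is a multiple of one letter; both modes are negative, so
  there is no central term.\<close>

lemma y_commute_G:
  assumes "v \<in> G d"
  shows "y e (y e' v) - y e' (y e v) \<in> G (Suc d)"
proof -
  have "y e (y e' v) - y e' (y e v) = sc (of_int (int e' - int e)) (y (e + e' + 2) v)"
    using om_commutator[of "- int e - 1" "- int e' - 1" v] by (simp add: y_def algebra_simps)
  then show ?thesis
    using assms by (simp add: y_G subspace_scale)
qed

text \<open>In the associativity formula the sum \<open>f\<close> adds one letter
  \<open>y (e + i)\<close> to a mode of the shorter word, and that mode stays nonnegative if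
  \<open>j\<close> is. In \<open>g\<close> only a nonnegative mode of \<open>om\<close> acts besides
  the shorter word, and it adds no length.\<close>

lemma Y_G_word:
  assumes "v \<in> G (Suc s)"
  shows "Y (word es) j v \<in> G (Suc (length es + s)) \<and> (j \<ge> 0 \<longrightarrow> Y (word es) j v \<in> G (length es + s))"
  using assms
proof (induction es arbitrary: s v j)
  case Nil
  then show ?case by (auto simp: Y_vac subspace_0)
next
  case (Cons e es)
  let ?u = "word es" and ?r = "- int e - 1" and ?d = "length es + s"
  define f where "f = (\<lambda>i. sc ((-1) ^ i * (of_int ?r gchoose i)) (Y om (?r - int i) (Y ?u (j + int i) v)))"
  define g where "g = (\<lambda>i. sc ((-1) ^ i * (of_int ?r gchoose i)) (Y ?u (j + ?r - int i) (Y om (int i) v)))"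
  have eq: "Y (word (e # es)) j v = fsum f - sc (if even ?r then 1 else -1) (fsum g)"
    using borcherds_associator[of om ?r ?u j v] unfolding f_def g_def word_simps y_def by simp
  have yi: "Y om (?r - int i) = y (e + i)" for i
    by (simp add: y_def algebra_simps)
  have g: "g i \<in> G (Suc ?d)" for i
    unfolding g_def using Cons.IH[OF Y_om_nonneg_G[OF Cons.prems, of "int i"]]
    by (intro subspace_scale subspace_G) simp
  have f1: "f i \<in> G (Suc (Suc ?d))" for i
    unfolding f_def yi using Cons.IH[of v s "j + int i"] Cons.prems
    by (auto intro!: subspace_scale y_G)
  have f0: "f i \<in> G (Suc ?d)" if "j \<ge> 0" for i
    unfolding f_def yi using Cons.IH[of v s "j + int i"] Cons.prems that
    by (auto intro!: subspace_scale y_G)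
  have fs: "fsum f \<in> G (Suc (Suc ?d))"
    by (intro fsum_mem subspace_G f1)
  have fs0: "fsum f \<in> G (Suc ?d)" if "j \<ge> 0"
    by (intro fsum_mem subspace_G f0 that)
  have gs: "sc (if even ?r then 1 else -1) (fsum g) \<in> G (Suc ?d)"
    by (intro subspace_scale fsum_mem subspace_G g)
  have "sc (if even ?r then 1 else -1) (fsum g) \<in> G (Suc (Suc ?d))"
    by (rule G_mono[OF _ gs]) simp
  then have "Y (word (e # es)) j v \<in> G (Suc (Suc ?d))"
    unfolding eq by (rule subspace_diff[OF subspace_G fs])
  moreover have "Y (word (e # es)) j v \<in> G (Suc ?d)" if "j \<ge> 0"
    unfolding eq by (rule subspace_diff[OF subspace_G fs0[OF that] gs])
  ultimately show ?case
    unfolding length_Cons add_Suc by simp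
qed

lemma Y_G:
  assumes "u \<in> G (Suc r)" "v \<in> G (Suc s)"
  shows "Y u j v \<in> G (Suc (r + s))"
proof -
  have "Y (word es) j v \<in> G (Suc (r + s))" if "length es < Suc r" for es
    by (rule G_mono[of "Suc (length es + s)"]) (use Y_G_word[OF assms(2), of es j] that in auto)
  then show ?thesis
    by (intro Y_left_span_mem[OF assms(1)[unfolded G_def] subspace_G]) blast
qed

text \<open>The commutator formula contains only modes of \<open>Y om i u\<close> with nonnegative
  \<open>i\<close>. These vectors are no longer than \<open>u\<close>, so the letter
  \<open>y e\<close> is lost.\<close>

lemma y_Y_commute_G:
  assumes "u \<in> G (Suc r)" "v \<in> G (Suc s)"
  shows "y e (Y u j v) - Y u j (y e v) \<in> G (Suc (r + s))"
  unfolding y_def borcherds_commutator using assms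
  by (intro fsum_mem subspace_scale subspace_G Y_G Y_om_nonneg_G) auto

lemma gchoose_neg_Suc: "(-1) ^ i * ((- of_nat e - 1 :: complex) gchoose i) = of_nat ((e + i) choose i)"
proof -
  have "- (of_nat e + 1) = (- of_nat e - 1 :: complex)"
    and "of_nat e + 1 + of_nat i - 1 = (of_nat (e + i) :: complex)"
    by simp_all
  then have "(- of_nat e - 1 :: complex) gchoose i = (-1) ^ i * (of_nat (e + i) gchoose i)"
    using gbinomial_minus[of "of_nat e + 1 :: complex" i] by metis
  then show ?thesis
    by (simp add: binomial_gbinomial flip: power_mult_distrib mult.assoc)
qed

text \<open>The sum is the coefficient of x^l in the \<open>e\<close>-th divided derivative of y(x)
  times the regular part of Y(word es, x)v. The discarded terms contain a nonnegative mode of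
  \<open>om\<close> or of \<open>word es\<close> and are therefore shorter.\<close>

lemma Y_word_expand:
  assumes v: "v \<in> G (Suc s)"
  shows "Y (word (e # es)) (- int l - 1) v -
      (\<Sum>i\<le>l. sc (of_nat ((e + i) choose i)) (y (e + i) (Y (word es) (- int (l - i) - 1) v)))
    \<in> G (Suc (length es + s))"
proof -
  let ?u = "word es" and ?r = "- int e - 1" and ?d = "length es + s" and ?j = "- int l - 1"
  define f where "f = (\<lambda>i. sc ((-1) ^ i * (of_int ?r gchoose i)) (Y om (?r - int i) (Y ?u (?j + int i) v)))"
  define g where "g = (\<lambda>i. sc ((-1) ^ i * (of_int ?r gchoose i)) (Y ?u (?j + ?r - int i) (Y om (int i) v)))"
  have eq: "Y (word (e # es)) ?j v = fsum f - sc (if even ?r then 1 else -1) (fsum g)"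
    using borcherds_associator[of om ?r ?u ?j v] unfolding f_def g_def word_simps y_def by simp
  have yi: "Y om (?r - int i) = y (e + i)" for i
    by (simp add: y_def algebra_simps)
  have coef: "(-1) ^ i * (of_int ?r gchoose i) = (of_nat ((e + i) choose i) :: complex)" for i
    using gchoose_neg_Suc[of i e] by simp
  have g: "fsum g \<in> G (Suc ?d)"
    unfolding g_def using Y_G_word[OF Y_om_nonneg_G[OF v]]
    by (auto intro!: fsum_mem subspace_scale)
  have f: "f i = sc (of_nat ((e + i) choose i)) (y (e + i) (Y ?u (?j + int i) v))" for i
    by (simp only: f_def yi coef)
  obtain N where N: "\<And>k. k \<ge> N \<Longrightarrow> Y ?u k v = 0"
    using truncation by blast
  have "fsum f - (\<Sum>i\<le>l. f i) \<in> G (Suc ?d)"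
  proof (rule fsum_diff_mem)
    fix i assume "i > l"
    then show "f i \<in> G (Suc ?d)"
      unfolding f using Y_G_word[OF v, of es "?j + int i"] by (auto intro!: subspace_scale y_G)
  next
    fix i assume "i \<ge> nat (N + int l + 1)"
    then show "f i = 0"
      by (simp add: f N y_simps)
  qed simp
  moreover have "(\<Sum>i\<le>l. f i) =
    (\<Sum>i\<le>l. sc (of_nat ((e + i) choose i)) (y (e + i) (Y ?u (- int (l - i) - 1) v)))"
    by (rule sum.cong) (auto simp: f of_nat_diff algebra_simps)
  moreover have swap: "a - b - d = a - d - b" for a b d :: 'v
    by (simp add: algebra_simps)
  ultimately show ?thesis
    unfolding eq using subspace_diff[OF subspace_G _ subspace_scale[OF subspace_G g]] swap by metis
qed

lemma sum_diff_mem: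
  assumes S: "subspace S"
    and "\<And>j. a < j \<Longrightarrow> j \<le> b \<Longrightarrow> f j \<in> S" "\<And>j. b < j \<Longrightarrow> j \<le> a \<Longrightarrow> f j \<in> S"
  shows "(\<Sum>j\<le>a. f j) - (\<Sum>j\<le>(b::nat). f j) \<in> S"
proof -
  have *: "(\<Sum>j\<le>b. f j) = (\<Sum>j\<le>a. f j) + (\<Sum>j\<in>{a<..b}. f j)" if "a \<le> b" for a b
    using that by (subst sum.union_disjoint[symmetric]) (auto intro!: sum.cong)
  show ?thesis
  proof (cases "a \<le> b")
    case True
    have "(\<Sum>j\<in>{a<..b}. f j) \<in> S"
      using assms by (intro subspace_sum) auto
    then show ?thesis
      using *[OF True] subspace_neg[OF S] by simp
  next
    case False
    have "(\<Sum>j\<in>{b<..a}. f j) \<in> S"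
      using assms by (intro subspace_sum) auto
    then show ?thesis
      using *[of b a] False by simp
  qed
qed

lemma sum_cong_mem:
  assumes "subspace S" "\<And>i. i \<in> A \<Longrightarrow> f i - g i \<in> S"
  shows "(\<Sum>i\<in>A. sc (a i) (f i)) - (\<Sum>i\<in>A. sc (a i) (g i)) \<in> S"
  using assms by (auto simp: sum_subtractf[symmetric] scale_right_diff_distrib[symmetric]
      intro!: subspace_sum subspace_scale)

lemma summand_mem:
  assumes "subspace S" "finite X" "x0 \<in> X" "a x0 \<noteq> 0"
    and "(\<Sum>x\<in>X. sc (a x) (f x)) \<in> S" "\<And>x. x \<in> X - {x0} \<Longrightarrow> f x \<in> S"
  shows "f x0 \<in> S"
proof -
  have "(\<Sum>x\<in>X - {x0}. sc (a x) (f x)) \<in> S"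
    using assms by (intro subspace_sum subspace_scale) auto
  then have "sc (a x0) (f x0) \<in> S"
    using assms sum.remove[of X x0 "\<lambda>x. sc (a x) (f x)"] by (metis add_diff_cancel_right' subspace_diff)
  then have "sc (inverse (a x0)) (sc (a x0) (f x0)) \<in> S"
    by (rule subspace_scale[OF assms(1)])
  moreover have "sc (inverse (a x0)) (sc (a x0) (f x0)) = f x0"
    using assms(4) by simp
  ultimately show ?thesis
    by metis
qed

section \<open>Weights and the product with the conformal vector\<close>

definition wt :: "nat list \<Rightarrow> nat" where
  "wt es = sum_list (map (\<lambda>e. e + 2) es)"

lemma homog_word: "homog sc Y om (wt es) (word es)"
  unfolding homog_def vL_def
proof (induction es)
  case Nil
  then show ?case by (simp add: wt_def Y_creation)
next
  case (Cons e es)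
  show ?case
    using om_commutator[of 1 "- int e - 1" "word es"] Cons
    by (simp add: wt_def y_def Y_right_simps algebra_simps)
qed

lemma word_0: "word [0] = om"
  by (simp add: y_def Y_creation_minus_one)

lemma om_nonzero: "om \<noteq> 0"
proof -
  have "pbw Y om vac [2] = om"
    by (simp add: pbw_def vL_def Y_creation_minus_one)
  moreover have "[2] \<in> pbw_lists"
    by (simp add: pbw_lists_def)
  ultimately show ?thesis
    using pbw_independent dependent_zero by (metis image_eqI)
qed

text \<open>Applying \<open>L(0) - k0\<close> kills the component of weight \<open>k0\<close> and
  multiplies the others by nonzero scalars.\<close>

lemma homog_components_zero:
  assumes "finite S" "\<And>k. k \<in> S \<Longrightarrow> homog sc Y om k (h k)" "(\<Sum>k\<in>S. h k) = 0" "k \<in> S"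
  shows "h k = 0"
  using assms
proof (induction S arbitrary: h k)
  case (insert k0 S)
  have L0: "Y om 1 (h k) = sc (of_nat k) (h k)" if "k \<in> insert k0 S" for k
    using insert.prems(1)[OF that] by (simp add: homog_def vL_def)
  have "0 = Y om 1 (\<Sum>k\<in>insert k0 S. h k) - sc (of_nat k0) (\<Sum>k\<in>insert k0 S. h k)"
    using insert.prems(2) by (simp add: Y_right_simps)
  also have "\<dots> = (\<Sum>k\<in>insert k0 S. sc (of_nat k - of_nat k0) (h k))"
    by (simp only: Y_right_simps scale_sum_right sum_subtractf[symmetric] L0 scale_left_diff_distrib cong: sum.cong)
  also have "\<dots> = (\<Sum>k\<in>S. sc (of_nat k - of_nat k0) (h k))"
    using insert.hyps by simp
  finally have "(\<Sum>k\<in>S. sc (of_nat k - of_nat k0) (h k)) = 0" ..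
  moreover have "homog sc Y om k (sc (of_nat k - of_nat k0) (h k))" if "k \<in> S" for k
    using L0[of k] that by (simp add: homog_def vL_def Y_right_simps mult.commute)
  ultimately have "sc (of_nat k - of_nat k0) (h k) = 0" if "k \<in> S" for k
    using insert.IH[of "\<lambda>k. sc (of_nat k - of_nat k0) (h k)"] that by blast
  then have S: "h k = 0" if "k \<in> S" for k
    using that insert.hyps by (metis eq_iff_diff_eq_0 of_nat_eq_iff scale_eq_0_iff)
  then have "h k0 = 0"
    using insert.prems(2) insert.hyps by simp
  then show ?case
    using S insert.prems(3) by auto
qed simp

text \<open>Because \<open>wcomp\<close> is a definite description, its value is known only after
  the weight decomposition of \<open>om\<close> is shown to be unique, which is
  \<open>homog_components_zero\<close> for a difference of two decompositions.\<close>

lemma wcomp_om: "wcomp sc Y om k om = (if k = 2 then om else 0)"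
proof -
  define f0 where "f0 = (\<lambda>k::nat. if k = 2 then om else 0)"
  have sup: "{k. f0 k \<noteq> 0} = {2}"
    using om_nonzero by (auto simp: f0_def)
  have hom: "homog sc Y om k (f0 k)" for k
    using homog_word[of "[0]"] by (simp add: f0_def wt_def word_0 homog_def vL_def Y_right_simps del: word_simps)
  have "wdecomp sc Y om om f0"
    unfolding wdecomp_def using hom sup by (simp add: f0_def)
  moreover have "f = f0" if "wdecomp sc Y om om f" for f
  proof
    fix k
    define S where "S = {k. f k \<noteq> 0} \<union> {2}"
    have f: "finite {k. f k \<noteq> 0}" "\<And>k. homog sc Y om k (f k)" "om = (\<Sum>k\<in>{k. f k \<noteq> 0}. f k)"
      using that by (auto simp: wdecomp_def)
    have fin: "finite S" using f(1) by (simp add: S_def)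
    have "(\<Sum>k\<in>S. f k) = om"
      unfolding f(3) using fin by (intro sum.mono_neutral_right) (auto simp: S_def)
    moreover have "(\<Sum>k\<in>S. f0 k) = om"
      using fin by (simp add: f0_def S_def)
    ultimately have "(\<Sum>k\<in>S. f k - f0 k) = 0"
      by (simp add: sum_subtractf)
    moreover have "homog sc Y om k (f k - f0 k)" for k
      using f(2)[of k] hom[of k] by (simp add: homog_def vL_def Y_right_simps scale_right_diff_distrib)
    ultimately have "f k - f0 k = 0" if "k \<in> S" for k
      using homog_components_zero[OF fin, of "\<lambda>k. f k - f0 k"] that by blast
    then show "f k = f0 k"
      by (cases "k \<in> S") (auto simp: S_def f0_def)
  qed
  ultimately have "(THE f. wdecomp sc Y om om f) = f0"
    by (intro the_equality)
  then show ?thesis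
    by (simp add: wcomp_def f0_def)
qed

lemma star_n_om: "star_n sc Y om n om v = star_h sc Y n 2 om v"
proof -
  have "{k. wcomp sc Y om k om \<noteq> 0} = {2}"
    using om_nonzero by (auto simp: wcomp_om)
  then show ?thesis
    by (simp add: star_n_def wcomp_om)
qed

lemma Y_word_1:
  assumes "v \<in> G (Suc s)"
  shows "Y (word [p]) (- int l - 1) v - sc (of_nat ((p + l) choose l)) (y (p + l) v) \<in> G (Suc s)"
proof -
  have "sc (of_nat ((p + i) choose i)) (y (p + i) (Y (word []) (- int (l - i) - 1) v)) =
      (if i = l then sc (of_nat ((p + l) choose l)) (y (p + l) v) else 0)" if "i \<le> l" for i
    using that by (auto simp: Y_vac y_simps)
  then have "(\<Sum>i\<le>l. sc (of_nat ((p + i) choose i)) (y (p + i) (Y (word []) (- int (l - i) - 1) v))) =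
      sc (of_nat ((p + l) choose l)) (y (p + l) v)"
    by simp
  then show ?thesis
    using Y_word_expand[OF assms, of p "[]" l] by (simp del: word_simps)
qed

section \<open>Reordering products of linear combinations of letters\<close>

text \<open>Contains the letters \<open>y e\<close> as well as the later operators
  \<open>B k\<close>, so that reordering is proved once for mixed products.\<close>

definition Op :: "('v \<Rightarrow> 'v) set" where
  "Op = {f. \<exists>a N. f = (\<lambda>v. \<Sum>e<N. sc (a e) (y e v))}"

lemma y_Op: "y e \<in> Op"
proof -
  have "y e = (\<lambda>v. \<Sum>i<Suc e. sc (if i = e then 1 else 0) (y i v))"
    by (simp add: sum.neutral if_distrib[of "\<lambda>x. sc x _"] cong: if_cong)
  then show ?thesis
    unfolding Op_def by (intro CollectI exI[of _ "\<lambda>i. if i = e then 1 else 0"] exI[of _ "Suc e"])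
qed

lemma Op_diff: "f \<in> Op \<Longrightarrow> f (u - v) = f u - f v"
  by (auto simp: Op_def y_simps scale_right_diff_distrib sum_subtractf)

lemma Op_G: "f \<in> Op \<Longrightarrow> v \<in> G d \<Longrightarrow> f v \<in> G (Suc d)"
  by (auto simp: Op_def intro!: subspace_sum subspace_scale y_G)

lemma Op_commute_G:
  assumes "f \<in> Op" "g \<in> Op" "v \<in> G d"
  shows "f (g v) - g (f v) \<in> G (Suc d)"
proof -
  obtain a M b N where f: "f = (\<lambda>v. \<Sum>e<M. sc (a e) (y e v))" and g: "g = (\<lambda>v. \<Sum>e<N. sc (b e) (y e v))"
    using assms by (auto simp: Op_def)
  have "f (g v) = (\<Sum>e<M. \<Sum>e'<N. sc (a e * b e') (y e (y e' v)))"
    unfolding f g by (simp add: y_simps scale_sum_right)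
  moreover have "g (f v) = (\<Sum>e<M. \<Sum>e'<N. sc (a e * b e') (y e' (y e v)))"
    unfolding f g by (subst sum.swap) (simp add: y_simps scale_sum_right mult.commute)
  ultimately have "f (g v) - g (f v) = (\<Sum>e<M. \<Sum>e'<N. sc (a e * b e') (y e (y e' v) - y e' (y e v)))"
    by (simp add: sum_subtractf scale_right_diff_distrib)
  also have "\<dots> \<in> G (Suc d)"
    using y_commute_G[OF assms(3)] by (intro subspace_sum subspace_scale subspace_G)
  finally show ?thesis .
qed

lemma Op_Y_commute_G:
  assumes "f \<in> Op" "u \<in> G (Suc r)" "v \<in> G (Suc s)"
  shows "f (Y u j v) - Y u j (f v) \<in> G (Suc (r + s))"
proof -
  obtain a N where f: "f = (\<lambda>v. \<Sum>e<N. sc (a e) (y e v))"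
    using assms by (auto simp: Op_def)
  have "f (Y u j v) - Y u j (f v) = (\<Sum>e<N. sc (a e) (y e (Y u j v) - Y u j (y e v)))"
    unfolding f by (simp add: Y_right_simps sum_subtractf scale_right_diff_distrib)
  also have "\<dots> \<in> G (Suc (r + s))"
    using y_Y_commute_G[OF assms(2,3)] by (intro subspace_sum subspace_scale subspace_G)
  finally show ?thesis .
qed

lemma foldr_Op_G:
  "set fs \<subseteq> Op \<Longrightarrow> v \<in> G d \<Longrightarrow> foldr (\<lambda>f. f) fs v \<in> G (length fs + d)"
  by (induction fs) (auto simp: Op_G)

lemma foldr_Op_move_G:
  assumes "f \<in> Op" "set fs \<subseteq> Op" "v \<in> G d"
  shows "foldr (\<lambda>f. f) fs (f v) - f (foldr (\<lambda>f. f) fs v) \<in> G (length fs + d)"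
  using assms(2)
proof (induction fs)
  case Nil
  then show ?case by (simp add: subspace_0)
next
  case (Cons g fs)
  let ?w = "foldr (\<lambda>f. f) fs v"
  have "g (foldr (\<lambda>f. f) fs (f v)) - g (f ?w) \<in> G (Suc (length fs + d))"
    using Cons Op_G[of g "foldr (\<lambda>f. f) fs (f v) - f ?w" "length fs + d"] Op_diff[of g] by simp
  moreover have "g (f ?w) - f (g ?w) \<in> G (Suc (length fs + d))"
    using Cons assms foldr_Op_G by (intro Op_commute_G) auto
  ultimately show ?case
    using diff_trans[OF subspace_G] by fastforce
qed

text \<open>Moving \<open>f\<close> through the prefix \<open>p\<close> of \<open>gs\<close> changes
  the vector only by a shorter one; the remaining factors are handled by induction.\<close>

lemma foldr_Op_perm_G:
  assumes "set fs \<subseteq> Op" "mset fs = mset gs"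
  shows "foldr (\<lambda>f. f) fs vac - foldr (\<lambda>f. f) gs vac \<in> G (length fs)"
  using assms
proof (induction fs arbitrary: gs)
  case Nil
  then show ?case by (simp add: subspace_0)
next
  case (Cons f fs)
  have "f \<in> set gs"
    using Cons.prems(2) by (metis list.set_intros(1) set_mset_mset)
  then obtain p q where gs: "gs = p @ f # q"
    by (meson split_list)
  have fs: "mset fs = mset (p @ q)"
    using Cons.prems(2) gs by simp
  have sub: "f \<in> Op" "set fs \<subseteq> Op" "set p \<subseteq> Op" "set q \<subseteq> Op"
    using Cons.prems(1) mset_eq_setD[OF fs] by auto
  have len: "length fs = length p + length q"
    using fs by (metis length_append size_mset)
  have "foldr (\<lambda>f. f) fs vac - foldr (\<lambda>f. f) (p @ q) vac \<in> G (length fs)"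
    using Cons.IH[OF sub(2) fs] .
  then have "f (foldr (\<lambda>f. f) fs vac) - f (foldr (\<lambda>f. f) (p @ q) vac) \<in> G (length (f # fs))"
    using Op_G[OF sub(1)] Op_diff[OF sub(1)] by (metis length_Cons)
  moreover have "f (foldr (\<lambda>f. f) p (foldr (\<lambda>f. f) q vac)) - foldr (\<lambda>f. f) p (f (foldr (\<lambda>f. f) q vac)) \<in> G (length (f # fs))"
  proof -
    have "vac \<in> G (Suc 0)" using word_G[of "[]" "Suc 0"] by simp
    then have "foldr (\<lambda>f. f) q vac \<in> G (length q + Suc 0)"
      by (rule foldr_Op_G[OF sub(4)])
    from foldr_Op_move_G[OF sub(1,3) this] have
      "foldr (\<lambda>f. f) p (f (foldr (\<lambda>f. f) q vac)) - f (foldr (\<lambda>f. f) p (foldr (\<lambda>f. f) q vac)) \<in> G (length (f # fs))"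
      by (simp add: len)
    from subspace_neg[OF subspace_G this] show ?thesis by simp
  qed
  ultimately have "f (foldr (\<lambda>f. f) fs vac) - foldr (\<lambda>f. f) p (f (foldr (\<lambda>f. f) q vac)) \<in> G (length (f # fs))"
    using diff_trans[OF subspace_G] by (metis comp_apply foldr_append)
  then show ?case
    by (simp add: gs)
qed

end

subsection \<open>Relations modulo the subspace\<close>

text \<open>Here \<open>W\<close> is an arbitrary member of the intersection defining
  \<open>gen_subalg\<close>; the goal is \<open>W = UNIV\<close>.\<close>

locale generated_subspace = virasoro_voa sc Y vac om c
  for sc :: "complex \<Rightarrow> 'v::ab_group_add \<Rightarrow> 'v" and Y vac om c +
  fixes n :: nat and W :: "'v set"
  assumes n: "1 \<le> n"
    and subspace_W: "subspace W"
    and O_n_W: "O_n sc Y om n \<subseteq> W"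
    and gens_W: "gens_n Y om vac n \<subseteq> W"
    and star_W: "\<And>u v. u \<in> W \<Longrightarrow> v \<in> W \<Longrightarrow> star_n sc Y om n u v \<in> W"
begin

lemmas W_intros = subspace_sum[OF subspace_W] subspace_scale[OF subspace_W] subspace_add[OF subspace_W]
  subspace_diff[OF subspace_W]

lemma om_W: "om \<in> W"
proof -
  have "(vL Y om (-2) ^^ 1) vac \<in> gens_n Y om vac n"
    unfolding gens_n_def by blast
  then show ?thesis
    using gens_W by (auto simp: vL_def Y_creation_minus_one)
qed

text \<open>Complex numbers rather than integers, since they serve as upper arguments of
  \<open>gchoose\<close>.\<close>

definition K :: "complex set" where
  "K = of_int ` ({- int n..int n} - {0})"

lemma finite_K [simp]: "finite K"
  by (simp add: K_def)

lemma card_K: "card K = 2 * n"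
proof -
  have "card K = card ({- int n..int n} - {0})"
    unfolding K_def by (rule card_image) (simp add: inj_on_def)
  then show ?thesis by simp
qed

lemma K_cases:
  assumes "k \<in> K"
  obtains i where "k = of_int i" "i \<noteq> 0" "\<bar>i\<bar> \<le> int n"
proof -
  from assms obtain i where "k = of_int i" "i \<in> {- int n..int n} - {0}"
    unfolding K_def by blast
  then show thesis
    by (intro that[of i]) auto
qed

text \<open>The inverse of the matrix \<open>(k - 2) gchoose e\<close>, whose existence is
  \<open>newton_dual_basis\<close>. It solves y(x) = sum of (1+x)^(k-2) B_k for the
  \<open>B k\<close> from the first \<open>2 * n\<close> coefficients.\<close>

definition \<beta> :: "complex \<Rightarrow> nat \<Rightarrow> complex" where
  "\<beta> = (SOME b. (\<forall>k\<in>K. \<forall>k'\<in>K. (\<Sum>e<2 * n. b k e * ((k' - 2) gchoose e)) = (if k' = k then 1 else 0)) \<and>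
    (\<forall>e<2 * n. \<forall>e'<2 * n. (\<Sum>k\<in>K. ((k - 2) gchoose e) * b k e') = (if e' = e then 1 else 0)))"

lemma \<beta>_dual:
  "k \<in> K \<Longrightarrow> k' \<in> K \<Longrightarrow> (\<Sum>e<2 * n. \<beta> k e * ((k' - 2) gchoose e)) = (if k' = k then 1 else 0)"
  "e < 2 * n \<Longrightarrow> e' < 2 * n \<Longrightarrow> (\<Sum>k\<in>K. ((k - 2) gchoose e) * \<beta> k e') = (if e' = e then 1 else 0)"
  using someI_ex[OF newton_dual_basis[OF finite_K, of 2, unfolded card_K], folded \<beta>_def] by blast+

definition B :: "complex \<Rightarrow> 'v \<Rightarrow> 'v" where
  "B k v = (\<Sum>e<2 * n. sc (\<beta> k e) (y e v))"

lemma B_Op: "B k \<in> Op"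
  unfolding Op_def by (intro CollectI exI[of _ "\<beta> k"] exI[of _ "2 * n"] ext) (rule B_def)

text \<open>The coefficient of \<open>x\<^sup>e\<close> in \<open>y(x) - \<Sum>\<^sub>k (1+x)\<^bsup>k-2\<^esup> B\<^sub>k\<close>.\<close>
definition R :: "nat \<Rightarrow> 'v \<Rightarrow> 'v" where
  "R e v = y e v - (\<Sum>k\<in>K. sc ((k - 2) gchoose e) (B k v))"

text \<open>A linear relation between coefficients that every (1+x)^(k-2) satisfies does not see the
  \<open>B k\<close> part of \<open>R\<close>.\<close>

lemma sum_R:
  assumes "finite X" "\<And>k. k \<in> K \<Longrightarrow> (\<Sum>x\<in>X. a x * ((k - 2) gchoose (t x))) = 0"
  shows "(\<Sum>x\<in>X. sc (a x) (R (t x) v)) = (\<Sum>x\<in>X. sc (a x) (y (t x) v))"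
proof -
  have "(\<Sum>x\<in>X. sc (a x) (\<Sum>k\<in>K. sc ((k - 2) gchoose (t x)) (B k v))) =
     (\<Sum>k\<in>K. sc (\<Sum>x\<in>X. a x * ((k - 2) gchoose (t x))) (B k v))"
    unfolding scale_sum_right scale_sum_left by (subst sum.swap) simp
  also have "\<dots> = 0"
    using assms(2) by simp
  finally show ?thesis
    by (simp add: R_def scale_right_diff_distrib sum_subtractf)
qed

lemma R_small:
  assumes "e < 2 * n"
  shows "R e v = 0"
proof -
  have "(\<Sum>k\<in>K. sc ((k - 2) gchoose e) (B k v)) =
    (\<Sum>e'<2 * n. sc (\<Sum>k\<in>K. ((k - 2) gchoose e) * \<beta> k e') (y e' v))"
    unfolding B_def scale_sum_right scale_sum_left by (subst sum.swap) simp
  also have "\<dots> = (\<Sum>e'<2 * n. if e' = e then y e v else 0)"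
    using assms by (intro sum.cong) (auto simp: \<beta>_dual)
  also have "\<dots> = y e v"
    using assms by simp
  finally show ?thesis
    by (simp add: R_def)
qed

text \<open>Summands of \<open>circ_n\<close> with \<open>j\<close> above \<open>2 * n + 1\<close>
  involve nonnegative modes, hence lie in \<open>W\<close>. What remains is the coefficient of
  x^(2n+1) in (1+x)^(wt+n) times the regular part of Y(word es, x)v.\<close>

lemma circ_word_W:
  assumes v: "v \<in> G (Suc s)" and GW: "G (length es + s) \<subseteq> W"
  shows "(\<Sum>j\<le>2 * n + 1. sc (of_nat ((wt es + n) choose j)) (Y (word es) (- int (2 * n + 1 - j) - 1) v)) \<in> W"
proof -
  define f where "f = (\<lambda>j. sc (of_nat ((wt es + n) choose j)) (Y (word es) (int j - 2 * int n - 2) v))"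
  have "circ_n sc Y n (wt es) (word es) v \<in> O_n sc Y om n"
    unfolding O_n_def using homog_word by (intro span_base UnI2) blast
  then have "(\<Sum>j\<le>wt es + n. f j) \<in> W"
    using O_n_W by (auto simp: circ_n_def f_def)
  moreover have "(\<Sum>j\<le>wt es + n. f j) - (\<Sum>j\<le>2 * n + 1. f j) \<in> W"
  proof (rule sum_diff_mem[OF subspace_W])
    fix j assume "wt es + n < j"
    then show "f j \<in> W"
      using subspace_0[OF subspace_W] by (simp add: f_def binomial_eq_0)
  next
    fix j assume "2 * n + 1 < j"
    then have "int j - 2 * int n - 2 \<ge> 0" by simp
    then show "f j \<in> W"
      unfolding f_def using Y_G_word[OF v] GW by (intro W_intros) blast
  qed
  ultimately have "(\<Sum>j\<le>2 * n + 1. f j) \<in> W"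
    using diff_mem_iff[OF subspace_W] by blast
  moreover have "(\<Sum>j\<le>2 * n + 1. f j) =
    (\<Sum>j\<le>2 * n + 1. sc (of_nat ((wt es + n) choose j)) (Y (word es) (- int (2 * n + 1 - j) - 1) v))"
    by (rule sum.cong) (auto simp: f_def of_nat_diff algebra_simps)
  ultimately show ?thesis by simp
qed

lemma star_om_W:
  assumes v: "v \<in> G d" and GW: "G d \<subseteq> W"
  shows "(\<Sum>m\<le>n. \<Sum>j\<le>n + m. sc ((-1) ^ m * of_nat ((m + n) choose n) * of_nat ((n + 2) choose j)) (y (n + m - j) v)) \<in> W"
proof -
  define f where "f = (\<lambda>m j. sc ((-1) ^ m * of_nat ((m + n) choose n) * of_nat ((2 + n) choose j))
        (Y om (int j - int n - int m - 1) v))"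
  have "(\<Sum>m\<le>n. \<Sum>j\<le>2 + n. f m j) \<in> W"
    using star_W[OF om_W, of v] v GW unfolding star_n_om star_h_def f_def by blast
  moreover have "(\<Sum>m\<le>n. \<Sum>j\<le>2 + n. f m j) - (\<Sum>m\<le>n. \<Sum>j\<le>n + m. f m j) \<in> W"
    unfolding sum_subtractf[symmetric]
  proof (intro subspace_sum[OF subspace_W] sum_diff_mem[OF subspace_W])
    fix m j assume "2 + n < j"
    then show "f m j \<in> W"
      using subspace_0[OF subspace_W] by (simp add: f_def binomial_eq_0)
  next
    fix m j assume "n + m < j"
    then have "int j - int n - int m - 1 \<ge> 0" by simp
    then show "f m j \<in> W"
      unfolding f_def using Y_om_nonneg_G[OF v] GW by (intro W_intros) blast
  qed
  ultimately have "(\<Sum>m\<le>n. \<Sum>j\<le>n + m. f m j) \<in> W"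
    using diff_mem_iff[OF subspace_W] by blast
  moreover have "(\<Sum>m\<le>n. \<Sum>j\<le>n + m. f m j) =
    (\<Sum>m\<le>n. \<Sum>j\<le>n + m. sc ((-1) ^ m * of_nat ((m + n) choose n) * of_nat ((n + 2) choose j)) (y (n + m - j) v))"
    by (intro sum.cong) (auto simp: f_def y_def of_nat_diff algebra_simps)
  ultimately show ?thesis by simp
qed

lemma circ_relation:
  assumes v: "v \<in> G (Suc s)" and GW: "G (Suc s) \<subseteq> W"
  shows "(\<Sum>j\<le>2 * n + 1. sc (of_nat ((p + 2 + n) choose j) * of_nat ((p + (2 * n + 1 - j)) choose (2 * n + 1 - j)))
    (y (p + (2 * n + 1 - j)) v)) \<in> W"
proof -
  have "(\<Sum>j\<le>2 * n + 1. sc (of_nat ((p + 2 + n) choose j)) (Y (word [p]) (- int (2 * n + 1 - j) - 1) v)) \<in> W"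
    using circ_word_W[OF v, of "[p]"] GW by (simp add: wt_def del: word_simps)
  moreover have "(\<Sum>j\<le>2 * n + 1. sc (of_nat ((p + 2 + n) choose j)) (Y (word [p]) (- int (2 * n + 1 - j) - 1) v)) -
    (\<Sum>j\<le>2 * n + 1. sc (of_nat ((p + 2 + n) choose j)) (sc (of_nat ((p + (2 * n + 1 - j)) choose (2 * n + 1 - j)))
    (y (p + (2 * n + 1 - j)) v))) \<in> W"
    using Y_word_1[OF v] GW by (intro sum_cong_mem subspace_W) blast
  ultimately show ?thesis
    using diff_mem_iff[OF subspace_W] by (simp only: scale_scale)
qed

text \<open>Each letter from \<open>2 * n\<close> on is the highest one in some relation: omega *_n
  v for \<open>2 * n\<close>, and the circle product with \<open>word [p]\<close> for
  \<open>2 * n + 1 + p\<close>. All (1+x)^(k-2) satisfy these relations, so by \<open>sum_R\<close>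
  they hold for \<open>R\<close>, and induction removes all terms but the highest.\<close>

lemma R_W:
  assumes v: "v \<in> G (Suc s)" and GW: "G (Suc s) \<subseteq> W"
  shows "R e v \<in> W"
proof (induction e rule: less_induct)
  case (less e)
  consider "e < 2 * n" | "e = 2 * n" | p where "e = 2 * n + 1 + p"
    by (metis add.commute add_Suc_right less_antisym less_iff_Suc_add not_less_iff_gr_or_eq plus_1_eq_Suc)
  then show ?case
  proof cases
    case 1
    then show ?thesis using R_small subspace_0[OF subspace_W] by simp
  next
    case 2
    define X where "X = Sigma {..n} (\<lambda>m. {..n + m})"
    define a where "a = (\<lambda>(m, j). (-1) ^ m * of_nat ((m + n) choose n) * of_nat ((n + 2) choose j) :: complex)"
    define t where "t = (\<lambda>(m, j). n + m - j)"
    have X: "(\<Sum>x\<in>X. f x) = (\<Sum>m\<le>n. \<Sum>j\<le>n + m. f (m, j))" for f :: "nat \<times> nat \<Rightarrow> 'b::comm_monoid_add"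
      unfolding X_def by (subst sum.Sigma) auto
    have fin: "finite X" by (simp add: X_def)
    have z: "(\<Sum>x\<in>X. a x * ((k - 2) gchoose (t x))) = 0" if k: "k \<in> K" for k
    proof -
      obtain i where i: "k = of_int i" "i \<noteq> 0" "\<bar>i\<bar> \<le> int n"
        using K_cases[OF k] .
      have "(\<Sum>j\<le>n + m. of_nat ((n + 2) choose j) * ((k - 2) gchoose (n + m - j))) = (of_int i + of_nat n) gchoose (n + m)" for m
        using gbinomial_vandermonde_le[of "of_nat (n + 2)" "k - 2" "n + m"]
        by (simp add: binomial_gbinomial i(1) algebra_simps)
      then have "(\<Sum>x\<in>X. a x * ((k - 2) gchoose (t x))) =
        (\<Sum>m\<le>n. (-1) ^ m * of_nat ((m + n) choose n) * (of_int i + of_nat n gchoose (n + m)))"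
        unfolding X by (simp add: a_def t_def mult.assoc sum_distrib_left[symmetric])
      then show ?thesis
        using star_kernel_zero[OF i(2,3)] by simp
    qed
    \<comment> \<open>The only pair whose letter is \<open>2 * n\<close>; its coefficient is
      binom(2n, n) up to sign.\<close>
    have 0: "(n, 0) \<in> X" "a (n, 0) \<noteq> 0"
      by (simp_all add: X_def a_def)
    have "(\<Sum>x\<in>X. sc (a x) (y (t x) v)) \<in> W"
      using star_om_W[OF v GW] by (simp add: X a_def t_def)
    then have "(\<Sum>x\<in>X. sc (a x) (R (t x) v)) \<in> W"
      by (simp only: sum_R[OF fin z])
    moreover have "R (t x) v \<in> W" if x: "x \<in> X - {(n, 0)}" for x
    proof -
      obtain m j where mj: "x = (m, j)" by (rule prod.exhaust)
      have "m \<le> n" "j \<le> n + m" "m \<noteq> n \<or> j \<noteq> 0"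
        using x by (auto simp: X_def mj)
      then have "t x < e"
        using n by (auto simp: mj t_def 2)
      then show ?thesis by (rule less.IH)
    qed
    ultimately have "R (t (n, 0)) v \<in> W"
      by (rule summand_mem[where a = a and f = "\<lambda>x. R (t x) v", OF subspace_W fin 0])
    then show ?thesis by (simp add: t_def 2 mult_2)
  next
    case (3 p)
    define a where "a = (\<lambda>j. of_nat ((p + 2 + n) choose j) * of_nat ((p + (2 * n + 1 - j)) choose (2 * n + 1 - j)) :: complex)"
    define t where "t = (\<lambda>j. p + (2 * n + 1 - j))"
    have z: "(\<Sum>j\<le>2 * n + 1. a j * ((k - 2) gchoose (t j))) = 0" if k: "k \<in> K" for k
    proof -
      obtain i where i: "k = of_int i" "i \<noteq> 0" "\<bar>i\<bar> \<le> int n"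
        using K_cases[OF k] .
      have "a j * ((k - 2) gchoose (t j)) =
        ((k - 2) gchoose p) * ((of_nat (p + 2 + n) gchoose j) * ((k - 2 - of_nat p) gchoose (2 * n + 1 - j)))" for j
        using gbinomial_iterated[of p "2 * n + 1 - j" "k - 2"]
        by (simp add: a_def t_def binomial_gbinomial mult_ac)
      then have "(\<Sum>j\<le>2 * n + 1. a j * ((k - 2) gchoose (t j))) =
        ((k - 2) gchoose p) * ((of_nat (p + 2 + n) + (k - 2 - of_nat p)) gchoose (2 * n + 1))"
        by (simp only: sum_distrib_left[symmetric] gbinomial_vandermonde_le)
      \<comment> \<open>The weight \<open>p + 2\<close> cancels, leaving an integer between 0 and
        \<open>2 * n\<close>, whose binomial coefficient over \<open>2 * n + 1\<close> is
        zero.\<close>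
      also have "of_nat (p + 2 + n) + (k - 2 - of_nat p) = of_int (i + int n)"
        by (simp add: i)
      also have "of_int (i + int n) gchoose (2 * n + 1) = (0 :: complex)"
        using i by (intro gbinomial_of_int_zero) auto
      finally show ?thesis by simp
    qed
    have 0: "0 \<in> {..2 * n + 1}" "a 0 \<noteq> 0"
      unfolding a_def of_nat_mult[symmetric] of_nat_eq_0_iff mult_eq_0_iff binomial_eq_0_iff by simp_all
    have "(\<Sum>j\<le>2 * n + 1. sc (a j) (y (t j) v)) \<in> W"
      unfolding a_def t_def by (rule circ_relation[OF v GW])
    then have "(\<Sum>j\<le>2 * n + 1. sc (a j) (R (t j) v)) \<in> W"
      by (simp only: sum_R[OF finite_atMost z])
    moreover have "R (t j) v \<in> W" if "j \<in> {..2 * n + 1} - {0}" for j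
      using that by (intro less.IH) (auto simp: t_def 3)
    ultimately have "R (t 0) v \<in> W"
      by (rule summand_mem[where a = a and f = "\<lambda>j. R (t j) v", OF subspace_W finite_atMost 0])
    then show ?thesis by (simp add: t_def 3 add.commute)
  qed
qed

section \<open>Circle products of words expressed by the operators B\<close>

text \<open>Replacing each \<open>L(-e-2)\<close> in the word \<open>es\<close> by the \<open>e\<close>-th divided derivative of
  \<open>\<Sum>\<^sub>k (1+x)\<^bsup>k-2\<^esup> B\<^sub>k\<close> and multiplying by \<open>(1+x)\<^bsup>N+wt\<^esup>\<close>, where \<open>wt\<close> is the weight of the word,
  turns \<open>Y(u,x)v\<close> into a series in which \<open>E es N l v\<close> is the coefficient of \<open>x\<^sup>l\<close>.\<close>
primrec E :: "nat list \<Rightarrow> complex \<Rightarrow> nat \<Rightarrow> 'v \<Rightarrow> 'v" where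
  "E [] N l v = sc (N gchoose l) v"
| "E (e # es) N l v = (\<Sum>k\<in>K. sc ((k - 2) gchoose e) (E es (N + k) l (B k v)))"

text \<open>Multiplication of the series behind \<open>E es N\<close> by (1+x)^a.\<close>

lemma E_vandermonde: "(\<Sum>i\<le>l. sc (a gchoose i) (E es N (l - i) v)) = E es (a + N) l v"
proof (induction es arbitrary: N v)
  case Nil
  then show ?case
    by (simp add: scale_sum_left[symmetric] gbinomial_vandermonde_le)
next
  case (Cons e es)
  have "(\<Sum>i\<le>l. sc (a gchoose i) (E (e # es) N (l - i) v)) =
    (\<Sum>k\<in>K. sc ((k - 2) gchoose e) (\<Sum>i\<le>l. sc (a gchoose i) (E es (N + k) (l - i) (B k v))))"
    unfolding E.simps scale_sum_right by (subst sum.swap) (simp add: mult.commute)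
  then show ?case
    by (simp add: Cons add.assoc)
qed

lemma Y_word_E:
  assumes v: "v \<in> G (Suc s)" and GW: "G (length es + s) \<subseteq> W"
  shows "Y (word es) (- int l - 1) v - E es (- of_nat (wt es)) l v \<in> W"
  using assms
proof (induction es arbitrary: s l v)
  case Nil
  then show ?case
    using subspace_0[OF subspace_W] by (auto simp: wt_def Y_vac gbinomial_0_left)
next
  case (Cons e es)
  let ?d = "Suc (length es + s)"
  have GW: "G ?d \<subseteq> W" using Cons.prems(2) by simp
  have word_G': "word es \<in> G (Suc (length es))" by (rule word_G) simp
  define x where "x i = Y (word es) (- int (l - i) - 1) v" for i
  define z where "z i k = E es (- of_nat (wt es)) (l - i) (B k v)" for i k
  have 1: "Y (word (e # es)) (- int l - 1) v - (\<Sum>i\<le>l. sc (of_nat ((e + i) choose i)) (y (e + i) (x i))) \<in> W"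
    using Y_word_expand[OF Cons.prems(1), of e es l] GW by (auto simp: x_def simp del: word_simps)
  have 2: "(\<Sum>i\<le>l. sc (of_nat ((e + i) choose i)) (y (e + i) (x i))) -
    (\<Sum>i\<le>l. sc (of_nat ((e + i) choose i)) (\<Sum>k\<in>K. sc ((k - 2) gchoose (e + i)) (B k (x i)))) \<in> W"
  proof (rule sum_cong_mem[OF subspace_W])
    fix i
    have "x i \<in> G ?d"
      unfolding x_def using Y_G_word[OF Cons.prems(1)] by simp
    from R_W[OF this GW, of "e + i"]
    show "y (e + i) (x i) - (\<Sum>k\<in>K. sc ((k - 2) gchoose (e + i)) (B k (x i))) \<in> W"
      by (simp add: R_def)
  qed
  \<comment> \<open>\<open>B k\<close> is moved inside, next to \<open>v\<close>, so that the
    induction hypothesis applies with \<open>B k v\<close>, one letter longer, while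
    \<open>es\<close> is one letter shorter.\<close>
  have Bx: "B k (x i) - z i k \<in> W" for i k
  proof (rule diff_trans[OF subspace_W])
    show "B k (x i) - Y (word es) (- int (l - i) - 1) (B k v) \<in> W"
      unfolding x_def using Op_Y_commute_G[OF B_Op word_G' Cons.prems(1)] GW by blast
    have "B k v \<in> G (Suc (Suc s))"
      by (rule Op_G[OF B_Op Cons.prems(1)])
    then show "Y (word es) (- int (l - i) - 1) (B k v) - z i k \<in> W"
      unfolding z_def using Cons.IH[of "B k v" "Suc s"] GW by simp
  qed
  have 3: "(\<Sum>i\<le>l. sc (of_nat ((e + i) choose i)) (\<Sum>k\<in>K. sc ((k - 2) gchoose (e + i)) (B k (x i)))) -
    (\<Sum>i\<le>l. sc (of_nat ((e + i) choose i)) (\<Sum>k\<in>K. sc ((k - 2) gchoose (e + i)) (z i k))) \<in> W"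
    by (intro sum_cong_mem[OF subspace_W] Bx)
  have "(\<Sum>i\<le>l. sc (of_nat ((e + i) choose i)) (\<Sum>k\<in>K. sc ((k - 2) gchoose (e + i)) (z i k))) =
    (\<Sum>k\<in>K. \<Sum>i\<le>l. sc (of_nat ((e + i) choose i) * ((k - 2) gchoose (e + i))) (z i k))"
    unfolding scale_sum_right by (subst sum.swap) simp
  also have "\<dots> = (\<Sum>k\<in>K. sc ((k - 2) gchoose e) (\<Sum>i\<le>l. sc ((k - 2 - of_nat e) gchoose i) (z i k)))"
    unfolding scale_sum_right gbinomial_iterated by simp
  also have "\<dots> = (\<Sum>k\<in>K. sc ((k - 2) gchoose e) (E es (k - 2 - of_nat e + - of_nat (wt es)) l (B k v)))"
    unfolding z_def E_vandermonde ..
  also have "\<dots> = E (e # es) (- of_nat (wt (e # es))) l v"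
    unfolding E.simps by (intro sum.cong refl arg_cong[where f = "sc _"] arg_cong2[where f = "\<lambda>N. E es N l"])
      (simp add: wt_def algebra_simps)
  finally show ?case
    using diff_trans[OF subspace_W 1 diff_trans[OF subspace_W 2 3]] by (simp only:)
qed

text \<open>The factor (1+x)^(wt+n) of the circle product cancels the exponent
  \<open>- wt es\<close> of \<open>Y_word_E\<close>.\<close>

lemma E_circ_W:
  assumes v: "v \<in> G (Suc s)" and GW: "G (length es + s) \<subseteq> W"
  shows "E es (of_nat n) (2 * n + 1) v \<in> W"
proof -
  have "(\<Sum>j\<le>2 * n + 1. sc (of_nat ((wt es + n) choose j)) (Y (word es) (- int (2 * n + 1 - j) - 1) v)) -
    (\<Sum>j\<le>2 * n + 1. sc (of_nat ((wt es + n) choose j)) (E es (- of_nat (wt es)) (2 * n + 1 - j) v)) \<in> W"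
    by (intro sum_cong_mem[OF subspace_W] Y_word_E[OF assms])
  then have "(\<Sum>j\<le>2 * n + 1. sc (of_nat ((wt es + n) choose j)) (E es (- of_nat (wt es)) (2 * n + 1 - j) v)) \<in> W"
    using circ_word_W[OF assms] diff_mem_iff[OF subspace_W] by blast
  then show ?thesis
    by (simp only: binomial_gbinomial E_vandermonde) simp
qed

text \<open>Combining the words with coefficients \<open>\<beta> k e\<close> in each position
  selects the index \<open>k\<close> there, by duality.\<close>

lemma E_isolate_W:
  assumes "\<And>es. length es = r \<Longrightarrow> E es N l v \<in> W" and k: "k \<in> K"
  shows "sc ((N + of_nat r * k) gchoose l) ((B k ^^ r) v) \<in> W"
  using assms(1)
proof (induction r arbitrary: N v)
  case 0
  from 0[of "[]"] show ?case by simp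
next
  case (Suc r)
  have "E es (N + k) l (B k v) \<in> W" if "length es = r" for es
  proof -
    have "(\<Sum>e<2 * n. sc (\<beta> k e) (E (e # es) N l v)) =
      (\<Sum>k'\<in>K. sc (\<Sum>e<2 * n. \<beta> k e * ((k' - 2) gchoose e)) (E es (N + k') l (B k' v)))"
      unfolding E.simps scale_sum_right scale_sum_left by (subst sum.swap) simp
    also have "\<dots> = (\<Sum>k'\<in>K. if k' = k then E es (N + k) l (B k v) else 0)"
      using k by (intro sum.cong) (auto simp: \<beta>_dual)
    also have "\<dots> = E es (N + k) l (B k v)"
      using k by simp
    finally show ?thesis
      using Suc.prems that W_intros(1,2) by (metis (no_types, lifting) length_Cons)
  qed
  from Suc.IH[OF this] show ?case
    by (simp add: funpow_swap1 algebra_simps)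
qed

lemma B_power_W:
  assumes "v \<in> G (Suc s)" "G (r + s) \<subseteq> W" "k \<in> K" "(of_nat n + of_nat r * k) gchoose (2 * n + 1) \<noteq> 0"
  shows "(B k ^^ r) v \<in> W"
proof -
  let ?a = "(of_nat n + of_nat r * k) gchoose (2 * n + 1)"
  have "sc ?a ((B k ^^ r) v) \<in> W"
    using E_circ_W[OF assms(1)] assms(2,3) by (intro E_isolate_W) auto
  then have "sc (inverse ?a) (sc ?a ((B k ^^ r) v)) \<in> W"
    by (rule W_intros)
  moreover have "sc (inverse ?a) (sc ?a ((B k ^^ r) v)) = (B k ^^ r) v"
    using assms(4) by simp
  ultimately show ?thesis by metis
qed

subsection \<open>Words in the operators B\<close>

definition Bword :: "complex list \<Rightarrow> 'v" where
  "Bword ks = foldr B ks vac"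

lemma Bword_simps [simp]: "Bword [] = vac" "Bword (k # ks) = B k (Bword ks)"
  by (simp_all add: Bword_def)

lemma mixed_word_eq: "foldr y es (Bword ks) = foldr (\<lambda>f. f) (map y es @ map B ks) vac"
  by (simp add: Bword_def foldr_map comp_def)

lemma mixed_word_perm_G:
  assumes "mset es = mset es'" "mset ks = mset ks'"
  shows "foldr y es (Bword ks) - foldr y es' (Bword ks') \<in> G (length es + length ks)"
  using foldr_Op_perm_G[of "map y es @ map B ks" "map y es' @ map B ks'"] assms y_Op B_Op
  unfolding mixed_word_eq by (auto simp del: foldr_append)

lemma mixed_word_G: "foldr y es (Bword ks) \<in> G (Suc (length es + length ks))"
  using foldr_Op_G[of "map y es @ map B ks" vac "Suc 0"] y_Op B_Op word_G[of "[]" "Suc 0"]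
  unfolding mixed_word_eq by (auto simp del: foldr_append)

lemma foldr_y_sum:
  "foldr y es (\<Sum>i\<in>A. sc (a i) (f i)) = (\<Sum>i\<in>A. sc (a i) (foldr y es (f i)))"
  by (induction es) (simp_all add: y_simps)

text \<open>By \<open>R_W\<close> the outermost letter becomes a combination of operators
  \<open>B k\<close>, each of which is moved inside past the other letters at the cost of shorter
  vectors.\<close>

lemma mixed_word_W:
  assumes "G d \<subseteq> W" "\<And>ks. length ks = d \<Longrightarrow> set ks \<subseteq> K \<Longrightarrow> Bword ks \<in> W"
    and "length es + length ks = d" "set ks \<subseteq> K"
  shows "foldr y es (Bword ks) \<in> W"
  using assms(3,4)
proof (induction es arbitrary: ks)
  case Nil
  then show ?case using assms(2) by simp
next
  case (Cons e es)
  let ?x = "foldr y es (Bword ks)"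
  have d: "d = Suc (length es + length ks)" using Cons.prems by simp
  have "R e ?x \<in> W"
    using R_W[OF mixed_word_G] assms(1) d by simp
  moreover have "B k ?x \<in> W" if k: "k \<in> K" for k
  proof -
    have "B k ?x - foldr y es (Bword (k # ks)) \<in> G d"
      using foldr_Op_perm_G[of "B k # map y es @ map B ks" "map y es @ map B (k # ks)"] y_Op B_Op d
      by (auto simp: Bword_def foldr_map comp_def)
    moreover have "foldr y es (Bword (k # ks)) \<in> W"
      using Cons.IH[of "k # ks"] Cons.prems k by simp
    ultimately show ?thesis
      using diff_mem_iff[OF subspace_W] assms(1) by blast
  qed
  then have "(\<Sum>k\<in>K. sc ((k - 2) gchoose e) (B k ?x)) \<in> W"
    by (intro W_intros)
  ultimately have "y e ?x \<in> W"
    using diff_mem_iff[OF subspace_W] unfolding R_def by blast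
  then show ?case by simp
qed

lemma B_repeated_W:
  assumes "G d \<subseteq> W" "length ks = d" "k \<in> K" "r \<le> count (mset ks) k"
    and "(of_nat n + of_nat r * k) gchoose (2 * n + 1) \<noteq> 0"
  shows "Bword ks \<in> W"
proof -
  obtain ks' where ks': "mset ks' = mset ks - replicate_mset r k"
    using ex_mset by blast
  have mset: "mset ks = mset (replicate r k @ ks')"
    using assms(4) ks' by (simp add: count_le_replicate_mset_subset_eq)
  then have len: "d = r + length ks'"
    using assms(2) by (metis length_append length_replicate size_mset)
  have "Bword (replicate r k @ ks') = (B k ^^ r) (Bword ks')"
    by (induction r) auto
  moreover have "(B k ^^ r) (Bword ks') \<in> W"
    using mixed_word_G[of "[]" ks'] assms len by (intro B_power_W[of _ "length ks'"]) auto
  moreover have "Bword ks - Bword (replicate r k @ ks') \<in> W"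
    using mixed_word_perm_G[of "[]" "[]", OF refl mset] assms by auto
  ultimately show ?thesis
    using diff_mem_iff[OF subspace_W] by metis
qed

section \<open>Words that occur among the generators\<close>

text \<open>The shift by 2 arises because letter \<open>M\<close> is L(-M-2), whereas exponents are
  indexed as in \<open>vir_word\<close>.\<close>

primrec desc_list :: "(nat \<Rightarrow> nat) \<Rightarrow> nat \<Rightarrow> nat list" where
  "desc_list i 0 = []"
| "desc_list i (Suc M) = replicate (i (M + 2)) M @ desc_list i M"

lemma vir_word_eq: "vir_word Y om vac i (M + 1) = word (desc_list i M)"
proof (induction M)
  case 0
  then show ?case by (simp add: vir_word_def)
next
  case (Suc M)
  have "- int (M + 2) + 1 = - int M - 1" by simp
  then have y: "vL Y om (- int (M + 2)) = y M"
    by (simp only: vL_def y_def)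
  have "vir_word Y om vac i (Suc M + 1) = (y M ^^ i (M + 2)) (vir_word Y om vac i (M + 1))"
    unfolding vir_word_def using y by simp
  moreover have "(y M ^^ j) (word es) = word (replicate j M @ es)" for j es
    by (induction j) auto
  ultimately show ?case using Suc by simp
qed

lemma count_desc_list: "count (mset (desc_list i M)) e = (if e < M then i (e + 2) else 0)"
  by (induction M) (auto simp: less_Suc_eq)

lemma word_gens_W:
  assumes "G (length es) \<subseteq> W" "\<And>e. e \<in> set es \<Longrightarrow> e < 2 * n" "2 * count (mset es) 0 \<le> n"
  shows "word es \<in> W"
proof -
  \<comment> \<open>Truncated subtraction gives \<open>i 0\<close> and \<open>i 1\<close> the value
    \<open>i 2\<close>, but \<open>vir_word\<close> reads exponents only from 2 on.\<close>
  define i where "i = (\<lambda>k. count (mset es) (k - 2))"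
  have "vir_word Y om vac i (2 * n + 1) \<in> gens_n Y om vac n"
    unfolding gens_n_def using assms(3) by (auto simp: i_def)
  then have "word (desc_list i (2 * n)) \<in> W"
    using gens_W vir_word_eq[of i "2 * n"] by auto
  moreover have "mset es = mset (desc_list i (2 * n))"
    using assms(2) by (intro multiset_eqI) (auto simp: count_desc_list i_def count_eq_zero_iff)
  then have "word es - word (desc_list i (2 * n)) \<in> G (length es)"
    using mixed_word_perm_G[of es _ "[]" "[]"] by (simp add: word_def)
  ultimately show ?thesis
    using assms(1) diff_mem_iff[OF subspace_W] by blast
qed

text \<open>At the point 2, which lies in \<open>K\<close> for \<open>n\<close> at least 2,
  \<open>(2 - 2) gchoose e\<close> vanishes except at \<open>e = 0\<close>, so duality there reads
  off \<open>\<beta> k 0\<close>.\<close>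

lemma \<beta>_0:
  assumes "2 \<le> n" "k \<in> K"
  shows "\<beta> k 0 = (if k = 2 then 1 else 0)"
proof -
  have "(2::complex) \<in> K"
    unfolding K_def using assms(1) by (intro image_eqI[of _ _ 2]) auto
  then have "(\<Sum>e<2 * n. \<beta> k e * ((2 - 2) gchoose e)) = (if 2 = k then 1 else 0)"
    using \<beta>_dual(1)[OF assms(2)] by blast
  moreover have "(\<Sum>e<2 * n. \<beta> k e * ((2 - 2) gchoose e)) = \<beta> k 0"
    using assms(1) by (simp add: gbinomial_0_left if_distrib[of "\<lambda>x. _ * x"] cong: if_cong)
  ultimately show ?thesis by simp
qed

text \<open>By \<open>\<beta>_0\<close>, expanding \<open>B k\<close> creates a letter \<open>0\<close>, i.e. an \<open>L(-2)\<close>, only if \<open>k = 2\<close>.\<close>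
lemma few_two_W:
  assumes "2 \<le> n" "G d \<subseteq> W" "length es + length ks = d" "set ks \<subseteq> K" "\<And>e. e \<in> set es \<Longrightarrow> e < 2 * n"
    and "2 * (count (mset es) 0 + count (mset ks) 2) \<le> n"
  shows "foldr y es (Bword ks) \<in> W"
  using assms(3-6)
proof (induction ks arbitrary: es)
  case Nil
  then show ?case
    using word_gens_W[of es] assms(2) by (simp add: word_def)
next
  case (Cons k ks)
  have "foldr y es (Bword (k # ks)) = (\<Sum>e<2 * n. sc (\<beta> k e) (foldr y (es @ [e]) (Bword ks)))"
    by (simp add: B_def foldr_y_sum)
  moreover have *: "sc (\<beta> k e) (foldr y (es @ [e]) (Bword ks)) \<in> W" if "e < 2 * n" for e
  proof (cases "\<beta> k e = 0")
    case True
    then show ?thesis using subspace_0[OF subspace_W] by simp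
  next
    case False
    then have "e = 0 \<longrightarrow> k = 2"
      using \<beta>_0[OF assms(1), of k] Cons.prems(2) by (cases "e = 0") (auto split: if_splits)
    then have "foldr y (es @ [e]) (Bword ks) \<in> W"
      using Cons.prems that by (intro Cons.IH) (auto split: if_splits)
    then show ?thesis by (rule W_intros)
  qed
  have "(\<Sum>e<2 * n. sc (\<beta> k e) (foldr y (es @ [e]) (Bword ks))) \<in> W"
    by (rule W_intros(1)) (rule *, simp)
  ultimately show ?case
    by (simp only:)
qed

lemma Bword_W_large:
  assumes n2: "2 \<le> n" and "G d \<subseteq> W" "length ks = d" "set ks \<subseteq> K"
  shows "Bword ks \<in> W"
proof (cases "2 * count (mset ks) 2 \<le> n")
  case True
  then show ?thesis
    using few_two_W[of d "[]" ks] assms by simp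
next
  case False
  \<comment> \<open>The least \<open>r\<close> with \<open>2 * r > n\<close>; then
    \<open>n + 2 * r\<close> is at least \<open>2 * n + 1\<close>.\<close>
  let ?r = "n div 2 + 1"
  have "(2::complex) \<in> K"
    unfolding K_def using n2 by (intro image_eqI[of _ _ 2]) auto
  moreover have "of_nat n + of_nat ?r * 2 = (of_nat (n + ?r * 2) :: complex)"
    by simp
  then have "(of_nat n + of_nat ?r * 2 :: complex) gchoose (2 * n + 1) \<noteq> 0"
    by (simp only: binomial_gbinomial[symmetric] of_nat_eq_0_iff binomial_eq_0_iff) auto
  ultimately show ?thesis
    using False assms by (intro B_repeated_W[of d _ 2 ?r]) auto
qed

section \<open>The case n = 1\<close>

lemma K_one: "K = {1, -1}" if "n = 1"
proof -
  have "{- int n..int n} - {0} = {1, -1}" using that by auto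
  then show ?thesis by (simp add: K_def)
qed

text \<open>A repeated index gives \<open>n + 2 * k\<close> equal to 3 or -1, and binom(3,3) and
  binom(-1,3) are nonzero. Otherwise each of 1 and -1 occurs at most once; the product of both is
  obtained from the generator L(-2)^2 1.\<close>

lemma Bword_W_one:
  assumes n1: "n = 1" and GW: "G d \<subseteq> W" and d: "length ks = d" and K: "set ks \<subseteq> K"
  shows "Bword ks \<in> W"
proof (cases "\<exists>k\<in>K. 2 \<le> count (mset ks) k")
  case True
  then obtain k where k: "k \<in> K" "2 \<le> count (mset ks) k" by blast
  have "k = 1 \<or> k = -1"
    using k(1) K_one[OF n1] by simp
  then have "(of_nat n + of_nat 2 * k) gchoose (2 * n + 1) \<noteq> 0"
    by (auto simp: n1 gbinomial_prod_rev numeral_eq_Suc)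
  then show ?thesis
    using B_repeated_W[OF GW d k] by blast
next
  case False
  note K1 = K_one[OF n1]
  have not_both: "count (mset ks) k \<le> 1" if "k \<in> K" for k
    using False that by (auto simp: not_le)
  consider "ks = []" | k where "ks = [k]" | k k' ks' where "ks = k # k' # ks'"
    by (metis list.exhaust)
  then show ?thesis
  proof cases
    case 1
    then show ?thesis
      using word_gens_W[of "[]"] GW d by simp
  next
    case (2 k)
    have "word [e] \<in> W" if "e < 2" for e
    \<comment> \<open>The word \<open>[0]\<close> violates the bound in \<open>word_gens_W\<close>,
      but it is the generator with \<open>j = 1\<close>.\<close>
    proof (cases "e = 0")
      case True
      then show ?thesis using om_W word_0 by simp
    next
      case False
      then show ?thesis
        using word_gens_W[of "[e]"] GW d 2 n1 that by simp
    qed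
    then have "(\<Sum>e<2 * n. sc (\<beta> k e) (y e vac)) \<in> W"
      using n1 by (intro W_intros(1,2)) simp
    then show ?thesis
      by (simp add: 2 B_def)
  next
    case (3 k k' ks')
    have kK: "k \<in> {1, -1}" "k' \<in> {1, -1}" "set ks' \<subseteq> {1, -1}"
      using K 3 K1 by auto
    have "k \<noteq> k'"
      using not_both[of k] 3 K by auto
    moreover have "ks' = []"
    proof (rule ccontr)
      assume "ks' \<noteq> []"
      then obtain j where j: "j \<in> set ks'"
        by (meson last_in_set)
      then have "j = k \<or> j = k'"
        using kK \<open>k \<noteq> k'\<close> by auto
      moreover have "0 < count (mset ks') j"
        using j by simp
      ultimately have "2 \<le> count (mset ks) j"
        unfolding 3 by auto
      then show False
        using not_both[of j] 3 K j by auto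
    qed
    ultimately have ks: "mset ks = mset [1, -1]" "d = 2"
      using kK 3 d by auto
    have G2: "G 2 \<subseteq> W" using GW ks by simp
    \<comment> \<open>Both coefficients \<open>(k - 2) gchoose 0\<close> are 1. Applying this to
      both letters of L(-2)^2 1 produces four products of two B's.\<close>
    have y0: "y 0 x - (B 1 x + B (-1) x) \<in> W" if "x \<in> G 2" for x
      using R_W[of x 1 0] that G2 by (simp add: R_def K1 numeral_2_eq_2)
    have vac1: "vac \<in> G 1" using word_G[of "[]" 1] by simp
    have Bvac: "B k vac \<in> G 2" for k
      using Op_G[OF B_Op vac1, of k] by (simp add: numeral_2_eq_2)
    have y00: "y 0 (y 0 vac) \<in> W"
    proof -
      have "vL Y om (-2) = y 0" by (simp add: vL_def y_def)
      then have "(y 0 ^^ 2) vac \<in> gens_n Y om vac n"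
        unfolding gens_n_def by (intro UnI2 CollectI exI[of _ 2]) simp
      then show ?thesis using gens_W by (auto simp: numeral_2_eq_2)
    qed
    have "y 0 vac \<in> G 2" using word_G[of "[0]" 2] by simp
    from y0[OF this] y00 have "B 1 (y 0 vac) + B (-1) (y 0 vac) \<in> W"
      using diff_mem_iff[OF subspace_W] by blast
    moreover have By: "B k (y 0 vac) - (B 1 (B k vac) + B (-1) (B k vac)) \<in> W" for k
    proof (rule diff_trans[OF subspace_W])
      show "B k (y 0 vac) - y 0 (B k vac) \<in> W"
        using Op_commute_G[OF B_Op y_Op vac1, of k 0] G2 by (auto simp: numeral_2_eq_2)
    qed (rule y0[OF Bvac])
    moreover have "(B 1 (y 0 vac) + B (-1) (y 0 vac)) -
        ((B 1 (B 1 vac) + B (-1) (B 1 vac)) + (B 1 (B (-1) vac) + B (-1) (B (-1) vac))) \<in> W"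
      using W_intros(3)[OF By[of 1] By[of "-1"]] by (simp add: algebra_simps)
    ultimately have sum4: "(B 1 (B 1 vac) + B (-1) (B 1 vac)) + (B 1 (B (-1) vac) + B (-1) (B (-1) vac)) \<in> W"
      using diff_mem_iff[OF subspace_W] by blast
    \<comment> \<open>The squares lie in \<open>W\<close>, so the four-term sum leaves only the two
      mixed products, which agree modulo \<open>W\<close>.\<close>
    have same: "B k (B k vac) \<in> W" if "k \<in> {1, -1}" for k
    proof -
      have "(of_nat n + of_nat 2 * k) gchoose (2 * n + 1) \<noteq> 0"
        using that by (auto simp: n1 gbinomial_prod_rev numeral_eq_Suc)
      from B_repeated_W[OF G2 _ _ _ this, of "[k, k]"] show ?thesis
        using that K1 by simp
    qed
    have "B (-1) (B 1 vac) + B 1 (B (-1) vac) =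
      (B 1 (B 1 vac) + B (-1) (B 1 vac)) + (B 1 (B (-1) vac) + B (-1) (B (-1) vac)) -
      B 1 (B 1 vac) - B (-1) (B (-1) vac)"
      by simp
    also have "\<dots> \<in> W"
      by (intro W_intros(4) sum4 same) simp_all
    finally have "B (-1) (B 1 vac) + B 1 (B (-1) vac) \<in> W" .
    moreover have "B (-1) (B 1 vac) - B 1 (B (-1) vac) \<in> W"
      using Op_commute_G[OF B_Op B_Op vac1, of "-1" 1] G2 by (auto simp: numeral_2_eq_2)
    ultimately have "sc (1/2) ((B (-1) (B 1 vac) + B 1 (B (-1) vac)) - (B (-1) (B 1 vac) - B 1 (B (-1) vac))) \<in> W"
      by (rule W_intros(2)[OF W_intros(4)])
    also have "(B (-1) (B 1 vac) + B 1 (B (-1) vac)) - (B (-1) (B 1 vac) - B 1 (B (-1) vac)) =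
      sc 1 (B 1 (B (-1) vac)) + sc 1 (B 1 (B (-1) vac))"
      by simp
    finally have "Bword [1, -1] \<in> W"
      unfolding scale_left_distrib[symmetric] by simp
    moreover have "Bword ks - Bword [1, -1] \<in> W"
      using mixed_word_perm_G[of "[]" "[]" ks "[1, -1]"] ks d G2 by (auto simp: numeral_2_eq_2)
    ultimately show ?thesis
      using diff_mem_iff[OF subspace_W] by blast
  qed
qed

text \<open>Once all shorter words lie in \<open>W\<close>, \<open>mixed_word_W\<close> reduces
  words of length \<open>d\<close> to products of B's, which the two cases for \<open>n\<close>
  cover.\<close>

lemma G_W: "G d \<subseteq> W"
proof (induction d)
  case 0
  then show ?case
    using subspace_0[OF subspace_W] by (simp add: G_def)
next
  case (Suc d)
  have "word es \<in> W" if "length es < Suc d" for es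
  proof (cases "length es = d")
    case True
    have "Bword ks \<in> W" if "length ks = d" "set ks \<subseteq> K" for ks
      using Bword_W_large[OF _ Suc that] Bword_W_one[OF _ Suc that] n by linarith
    from mixed_word_W[OF Suc this, of es "[]"] True show ?thesis
      by (simp add: word_def)
  next
    case False
    then show ?thesis
      using that Suc word_G[of es d] by auto
  qed
  then show ?case
    unfolding G_def by (intro span_minimal subspace_W) auto
qed

lemma W_UNIV: "W = UNIV"
proof -
  have "pbw Y om vac ms \<in> W" if "ms \<in> pbw_lists" for ms
  proof -
    have "\<forall>m\<in>set ms. 2 \<le> m" using that by (simp add: pbw_lists_def)
    then have "pbw Y om vac ms = word (map (\<lambda>m. m - 2) ms)"
      by (induction ms) (auto simp: pbw_def vL_def y_def of_nat_diff)
    then show ?thesis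
      using G_W word_G[OF lessI] by auto
  qed
  then have "span (pbw Y om vac ` pbw_lists) \<subseteq> W"
    by (intro span_minimal subspace_W) auto
  then show ?thesis
    using pbw_span by auto
qed

end

theorem theorem6p11:
  fixes sc :: "complex \<Rightarrow> 'v::ab_group_add \<Rightarrow> 'v"
    and Y :: "'v \<Rightarrow> int \<Rightarrow> 'v \<Rightarrow> 'v"
    and vac om :: 'v and c :: complex and n :: nat
  assumes "vir_voa sc Y vac om c"
    and "1 \<le> n"
  shows "gen_subalg sc Y om n (gens_n Y om vac n) = UNIV"
proof -
  interpret vector_space sc
    using assms(1) by (simp add: vir_voa_def)
  interpret virasoro_voa sc Y vac om c
    by unfold_locales (rule assms(1))
  have "W = UNIV" if "subspace W" "O_n sc Y om n \<subseteq> W" "gens_n Y om vac n \<subseteq> W"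
    "\<forall>u\<in>W. \<forall>v\<in>W. star_n sc Y om n u v \<in> W" for W
  proof -
    interpret generated_subspace sc Y vac om c n W
      by unfold_locales (use assms(2) that in auto)
    show ?thesis by (rule W_UNIV)
  qed
  then show ?thesis
    unfolding gen_subalg_def by blast
qed

end
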